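(* Suppose that $z^*$ is a solution of (NLP) at which MFCQ, the second-order conditions, and the strict complementarity condition SC are satisfied. Let $C>0$ and $\gamma\in(0,1)$ be fixed. Then for all $(z,\lambda)$ with $\lambda\ge0$ for which there is a vector $s$ such that $(z,\lambda,s)$ satisfies the centrality conditions (with constants $C,\gamma$), we have $\delta(z,\lambda)=O(\mu)$, where $\mu=\lambda^Ts/m$; that is, there exist $\epsilon>0$ and $K>0$ such that $\delta(z,\lambda)\le K\mu$ for all such $(z,\lambda,s)$ with $\delta(z,\lambda)\le\epsilon$ and $\mu\le\epsilon$.
   Context: (NLP) is $\min_z\phi(z)$ subject to $g(z)\le0$, where $\phi:\mathbb{R}^n\to\mathbb{R}$ and $g:\mathbb{R}^n\to\mathbb{R}^m$ are twice Lipschitz continuously differentiable. $\mathcal{L}(z,\lambda)=\phi(z)+\lambda^Tg(z)$; $\mathcal{L}_z$, $\mathcal{L}_{zz}$ are its gradient and Hessian in $z$. KKT conditions (necessary at a solution under MFCQ): $\mathcal{L}_z(z,\lambda)=0$, $g(z)\le0$, $\lambda\ge0$, $\lambda^Tg(z)=0$. $\mathcal{S}_\lambda$ is the (nonempty) set of $\lambda^*$ such that $(z^*,\lambda^* )$ satisfies the KKT conditions, $\mathcal{S}=\{z^*\}\times\mathcal{S}_\lambda$, and $\delta(z,\lambda)$ is the Euclidean distance from $(z,\lambda)$ to $\mathcal{S}$. $\mathcal{B}=\{i:g_i(z^* )=0\}$, $\mathcal{B}_+=\{i\in\mathcal{B}:\lambda_i^*>0\text{ for some }\lambda^*\in\mathcal{S}_\lambda\}$.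 MFCQ: there is $\bar y\in\mathbb{R}^n$ with $\nabla g_i(z^* )^T\bar y<0$ for all $i\in\mathcal{B}$. Second-order conditions: there is $\xi>0$ with $w^T\mathcal{L}_{zz}(z^*,\lambda^* )w\ge\xi\|w\|^2$ for all $\lambda^*\in\mathcal{S}_\lambda$ and all $w$ with $\nabla g_i(z^* )^Tw=0$ for $i\in\mathcal{B}_+$ and $\nabla g_i(z^* )^Tw\le0$ for $i\in\mathcal{B}\setminus\mathcal{B}_+$. SC: there is $\lambda^*\in\mathcal{S}_\lambda$ with $\lambda_i^*>0$ for all $i\in\mathcal{B}$. Centrality conditions, with $\mu=\lambda^Ts/m$: $\|\mathcal{L}_z(z,\lambda)\|\le C\mu$; $\|g(z)+s\|\le C\mu$; $(\lambda,s)>0$ and $\lambda_is_i\ge\gamma\mu$ for all $i=1,\dots,m$. *)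

theory Defs
  imports "HOL-Analysis.Analysis"
begin

definition grad :: "(real ^ 'n \<Rightarrow> real) \<Rightarrow> real ^ 'n \<Rightarrow> real ^ 'n" where
  "grad f z = (THE d. GDERIV f z :> d)"

definition hess :: "(real ^ 'n \<Rightarrow> real) \<Rightarrow> real ^ 'n \<Rightarrow> real ^ 'n ^ 'n" where
  "hess f z = jacobian (grad f) (at z)"

(* The Hessian is only required to be locally Lipschitz; this includes functions whose Hessian
   is globally Lipschitz. Continuity of the Hessian follows. *)
definition twice_Lipschitz_differentiable :: "(real ^ 'n \<Rightarrow> real) \<Rightarrow> bool" where
  "twice_Lipschitz_differentiable f \<longleftrightarrow>
     (\<forall>z. f differentiable (at z)) \<and>
     (\<forall>z. grad f differentiable (at z)) \<and>
     (\<forall>z. \<exists>r>0. \<exists>L. L-lipschitz_on (ball z r) (hess f))"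

definition feasible :: "(real ^ 'n \<Rightarrow> real ^ 'm) \<Rightarrow> (real ^ 'n) set" where
  "feasible g = {z. \<forall>i. g z $ i \<le> 0}"

(* A solution is a local minimizer of phi on the feasible set; global minimizers are included. *)
definition nlp_solution :: "(real ^ 'n \<Rightarrow> real) \<Rightarrow> (real ^ 'n \<Rightarrow> real ^ 'm) \<Rightarrow> real ^ 'n \<Rightarrow> bool" where
  "nlp_solution \<phi> g zs \<longleftrightarrow>
     zs \<in> feasible g \<and> (\<exists>r>0. \<forall>z \<in> feasible g \<inter> ball zs r. \<phi> zs \<le> \<phi> z)"

definition lagrangian ::
  "(real ^ 'n \<Rightarrow> real) \<Rightarrow> (real ^ 'n \<Rightarrow> real ^ 'm) \<Rightarrow> real ^ 'n \<Rightarrow> real ^ 'm \<Rightarrow> real" where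
  "lagrangian \<phi> g z l = \<phi> z + l \<bullet> g z"

definition lagr_grad ::
  "(real ^ 'n \<Rightarrow> real) \<Rightarrow> (real ^ 'n \<Rightarrow> real ^ 'm) \<Rightarrow> real ^ 'n \<Rightarrow> real ^ 'm \<Rightarrow> real ^ 'n" where
  "lagr_grad \<phi> g z l = grad (\<lambda>x. lagrangian \<phi> g x l) z"

definition lagr_hess ::
  "(real ^ 'n \<Rightarrow> real) \<Rightarrow> (real ^ 'n \<Rightarrow> real ^ 'm) \<Rightarrow> real ^ 'n \<Rightarrow> real ^ 'm \<Rightarrow> real ^ 'n ^ 'n" where
  "lagr_hess \<phi> g z l = hess (\<lambda>x. lagrangian \<phi> g x l) z"

definition kkt ::
  "(real ^ 'n \<Rightarrow> real) \<Rightarrow> (real ^ 'n \<Rightarrow> real ^ 'm) \<Rightarrow> real ^ 'n \<Rightarrow> real ^ 'm \<Rightarrow> bool" where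
  "kkt \<phi> g z l \<longleftrightarrow>
     lagr_grad \<phi> g z l = 0 \<and> (\<forall>i. g z $ i \<le> 0) \<and> (\<forall>i. 0 \<le> l $ i) \<and> l \<bullet> g z = 0"

definition multipliers ::
  "(real ^ 'n \<Rightarrow> real) \<Rightarrow> (real ^ 'n \<Rightarrow> real ^ 'm) \<Rightarrow> real ^ 'n \<Rightarrow> (real ^ 'm) set" where
  "multipliers \<phi> g zs = {l. kkt \<phi> g zs l}"

(* The product metric on pairs is Euclidean. The set of multipliers is nonempty under either
   mfcq (at a solution) or strict_compl, so the convention infdist x {} = 0 plays no role. *)
definition sol_dist ::
  "(real ^ 'n \<Rightarrow> real) \<Rightarrow> (real ^ 'n \<Rightarrow> real ^ 'm) \<Rightarrow> real ^ 'n \<Rightarrow> real ^ 'n \<Rightarrow> real ^ 'm \<Rightarrow> real" where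
  "sol_dist \<phi> g zs z l = infdist (z, l) ({zs} \<times> multipliers \<phi> g zs)"

definition active :: "(real ^ 'n \<Rightarrow> real ^ 'm) \<Rightarrow> real ^ 'n \<Rightarrow> 'm set" where
  "active g zs = {i. g zs $ i = 0}"

definition strongly_active ::
  "(real ^ 'n \<Rightarrow> real) \<Rightarrow> (real ^ 'n \<Rightarrow> real ^ 'm) \<Rightarrow> real ^ 'n \<Rightarrow> 'm set" where
  "strongly_active \<phi> g zs = {i \<in> active g zs. \<exists>l \<in> multipliers \<phi> g zs. 0 < l $ i}"

definition mfcq :: "(real ^ 'n \<Rightarrow> real ^ 'm) \<Rightarrow> real ^ 'n \<Rightarrow> bool" where
  "mfcq g zs \<longleftrightarrow> (\<exists>y. \<forall>i \<in> active g zs. grad (\<lambda>x. g x $ i) zs \<bullet> y < 0)"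

definition second_order ::
  "(real ^ 'n \<Rightarrow> real) \<Rightarrow> (real ^ 'n \<Rightarrow> real ^ 'm) \<Rightarrow> real ^ 'n \<Rightarrow> bool" where
  "second_order \<phi> g zs \<longleftrightarrow>
     (\<exists>\<xi>>0. \<forall>l \<in> multipliers \<phi> g zs. \<forall>w.
        (\<forall>i \<in> strongly_active \<phi> g zs. grad (\<lambda>x. g x $ i) zs \<bullet> w = 0) \<and>
        (\<forall>i \<in> active g zs - strongly_active \<phi> g zs. grad (\<lambda>x. g x $ i) zs \<bullet> w \<le> 0)
        \<longrightarrow> w \<bullet> (lagr_hess \<phi> g zs l *v w) \<ge> \<xi> * (norm w)\<^sup>2)"

definition strict_compl ::
  "(real ^ 'n \<Rightarrow> real) \<Rightarrow> (real ^ 'n \<Rightarrow> real ^ 'm) \<Rightarrow> real ^ 'n \<Rightarrow> bool" where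
  "strict_compl \<phi> g zs \<longleftrightarrow> (\<exists>l \<in> multipliers \<phi> g zs. \<forall>i \<in> active g zs. 0 < l $ i)"

definition compl_gap :: "real ^ 'm \<Rightarrow> real ^ 'm \<Rightarrow> real" where
  "compl_gap l s = (l \<bullet> s) / real CARD('m)"

definition centrality ::
  "(real ^ 'n \<Rightarrow> real) \<Rightarrow> (real ^ 'n \<Rightarrow> real ^ 'm) \<Rightarrow> real \<Rightarrow> real \<Rightarrow>
   real ^ 'n \<Rightarrow> real ^ 'm \<Rightarrow> real ^ 'm \<Rightarrow> bool" where
  "centrality \<phi> g C \<gamma> z l s \<longleftrightarrow>
     norm (lagr_grad \<phi> g z l) \<le> C * compl_gap l s \<and>
     norm (g z + s) \<le> C * compl_gap l s \<and>
     (\<forall>i. 0 < l $ i \<and> 0 < s $ i \<and> l $ i * s $ i \<ge> \<gamma> * compl_gap l s)"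

end

theory Submission
  imports Defs "HOL-Library.Landau_Symbols"
begin

text \<open>
  Write \<open>z\<^sub>0\<close> for the solution, \<open>\<Delta> = z - z\<^sub>0\<close> and \<open>d = \<parallel>\<Delta>\<parallel>\<close>. Comparing the stationarity residual with that of a strictly
  complementary multiplier \<open>\<nu>\<close> gives \<open>\<Sum>\<^sub>B \<nu>\<^sub>i s\<^sub>i = O(\<mu> + d\<^sup>2)\<close>, hence \<open>s\<^sub>B = O(\<mu> + d\<^sup>2)\<close>, so \<open>\<Delta>\<close> lies
  within \<open>O(\<mu> + d\<^sup>2)\<close> of the critical subspace and the second-order condition bounds \<open>d\<^sup>2\<close> by the
  quadratic form of the Hessian. Expanding \<open>\<Delta> \<bullet> L\<^sub>z(z, \<lambda>)\<close> around a multiplier \<open>\<lambda>\<^sub>0\<close> near \<open>\<lambda>\<close>, that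
  form equals \<open>- (\<lambda> - \<lambda>\<^sub>0) \<bullet> (g(z) - g(z\<^sub>0))\<close> up to \<open>O(d \<mu>) + o(d\<^sup>2)\<close>. A sign argument first yields
  \<open>d\<^sup>2 = O(\<mu>)\<close>. Then \<open>s\<^sub>B = O(\<mu>)\<close>, and centrality keeps \<open>\<lambda>\<^sub>B\<close> away from \<open>0\<close>; therefore projecting \<open>\<lambda>\<close>
  onto the affine hull of the multipliers stays in the multiplier set and moves \<open>\<lambda>\<close> by only
  \<open>O(\<mu> + d)\<close>. Repeating the expansion around this projection gives \<open>d\<^sup>2 = O(\<mu>\<^sup>2 + d \<mu>)\<close>, that is
  \<open>d = O(\<mu>)\<close>. All estimates are made along a hypothetical sequence of counterexamples.
\<close>

section \<open>Gradients and Hessians of the Lagrangian\<close>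

lemma has_derivative_grad:
  fixes f :: "real ^ 'n \<Rightarrow> real"
  assumes "f differentiable (at x)"
  shows "(f has_derivative (\<lambda>h. h \<bullet> grad f x)) (at x)"
proof -
  obtain f' where f': "(f has_derivative f') (at x)"
    using assms by (auto simp: differentiable_def)
  then interpret f': linear f' by (rule has_derivative_linear)
  \<comment> \<open>\<open>adjoint f' 1\<close> is the Riesz representative of the functional
    \<open>f'\<close>. This gives existence for the definite description in \<open>grad\<close>;
    uniqueness follows from uniqueness of derivatives.\<close>
  have "GDERIV f x :> adjoint f' 1"
    unfolding gderiv_def using f' adjoint_works[OF f'.linear_axioms, of _ 1]
    by (simp add: inner_commute)
  moreover have "d = adjoint f' 1" if "GDERIV f x :> d" for d
  proof -
    have "(\<lambda>h. h \<bullet> d) = (\<lambda>h. h \<bullet> adjoint f' 1)"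
      using that \<open>GDERIV f x :> adjoint f' 1\<close> unfolding gderiv_def by (rule has_derivative_unique)
    then have "\<forall>h. h \<bullet> d = h \<bullet> adjoint f' 1" by (auto dest: fun_cong)
    then show ?thesis by (simp only: vector_eq_ldot)
  qed
  ultimately have "GDERIV f x :> grad f x"
    unfolding grad_def by (rule theI)
  then show ?thesis by (simp add: gderiv_def)
qed

lemma grad_eqI:
  assumes "(f has_derivative (\<lambda>h. h \<bullet> d)) (at x)"
  shows "grad f x = d"
proof -
  have "f differentiable (at x)" using assms by (rule differentiableI)
  then have "(\<lambda>h. h \<bullet> d) = (\<lambda>h. h \<bullet> grad f x)"
    by (rule has_derivative_unique[OF assms has_derivative_grad])
  then have "\<forall>h. h \<bullet> d = h \<bullet> grad f x" by (auto dest: fun_cong)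
  then show ?thesis by (simp only: vector_eq_ldot)
qed

lemma hess_mult_eqI:
  assumes "(grad f has_derivative f') (at x)"
  shows "hess f x *v w = f' w"
proof -
  have "grad f differentiable (at x)" using assms by (rule differentiableI)
  then have "(grad f has_derivative (\<lambda>h. hess f x *v h)) (at x)"
    by (simp add: jacobian_works hess_def)
  from has_derivative_unique[OF this assms] show ?thesis by (rule fun_cong)
qed

lemma has_derivative_hess:
  assumes "grad f differentiable (at x)"
  shows "(grad f has_derivative (\<lambda>h. hess f x *v h)) (at x)"
  using assms by (simp add: jacobian_works hess_def)

lemma lagr_grad_eq:
  fixes g :: "real ^ 'n \<Rightarrow> real ^ 'm"
  assumes "\<phi> differentiable (at x)" "\<And>i. (\<lambda>y. g y $ i) differentiable (at x)"
  shows "lagr_grad \<phi> g x l = grad \<phi> x + (\<Sum>i\<in>UNIV. l $ i *\<^sub>R grad (\<lambda>y. g y $ i) x)"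
  unfolding lagr_grad_def lagrangian_def inner_vec_def inner_real_def
proof (rule grad_eqI)
  have "((\<lambda>y. \<phi> y + (\<Sum>i\<in>UNIV. l $ i * g y $ i)) has_derivative
      (\<lambda>h. h \<bullet> grad \<phi> x + (\<Sum>i\<in>UNIV. l $ i * (h \<bullet> grad (\<lambda>y. g y $ i) x)))) (at x)"
    by (intro has_derivative_add has_derivative_sum has_derivative_mult_right has_derivative_grad assms)
  then show "((\<lambda>y. \<phi> y + (\<Sum>i\<in>UNIV. l $ i * g y $ i)) has_derivative
      (\<lambda>h. h \<bullet> (grad \<phi> x + (\<Sum>i\<in>UNIV. l $ i *\<^sub>R grad (\<lambda>y. g y $ i) x)))) (at x)"
    by (simp add: inner_add_right inner_sum_right)
qed

lemma lagr_hess_mult_eq: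
  fixes g :: "real ^ 'n \<Rightarrow> real ^ 'm"
  assumes "\<And>x. \<phi> differentiable (at x)" "\<And>x i. (\<lambda>y. g y $ i) differentiable (at x)"
    and "grad \<phi> differentiable (at x)" "\<And>i. grad (\<lambda>y. g y $ i) differentiable (at x)"
  shows "lagr_hess \<phi> g x l *v w =
    hess \<phi> x *v w + (\<Sum>i\<in>UNIV. l $ i *\<^sub>R (hess (\<lambda>y. g y $ i) x *v w))"
proof -
  have "grad (\<lambda>y. lagrangian \<phi> g y l) = (\<lambda>x. grad \<phi> x + (\<Sum>i\<in>UNIV. l $ i *\<^sub>R grad (\<lambda>y. g y $ i) x))"
    using lagr_grad_eq[OF assms(1,2)] by (auto simp: lagr_grad_def)
  then show ?thesis
    unfolding lagr_hess_def
    by (intro hess_mult_eqI)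
      (simp, intro has_derivative_add has_derivative_sum has_derivative_scaleR_right has_derivative_hess assms)
qed

section \<open>Taylor remainders along convergent sequences\<close>

lemma has_derivative_smallo:
  assumes "(f has_derivative f') (at a)" "x \<longlonglongrightarrow> a"
  shows "(\<lambda>k. norm (f (x k) - f a - f' (x k - a))) \<in> o(\<lambda>k. norm (x k - a))"
proof (rule landau_o.smallI)
  fix c :: real assume "c > 0"
  with assms(1) obtain r where r: "r > 0"
      "\<And>y. norm (y - a) < r \<Longrightarrow> norm (f y - f a - f' (y - a)) \<le> c * norm (y - a)"
    unfolding has_derivative_at_alt by blast
  have "eventually (\<lambda>k. norm (x k - a) < r) sequentially"
    using assms(2) r(1) by (auto simp: tendsto_iff dist_norm)
  then show "eventually (\<lambda>k. norm (norm (f (x k) - f a - f' (x k - a))) \<le> c * norm (norm (x k - a))) sequentially"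
    by eventually_elim (use r(2) in auto)
qed

text \<open>Differentiability of the gradient at \<open>a\<close> bounds
  \<open>grad f y - grad f a\<close> by a multiple of \<open>norm (y - a)\<close> near
  \<open>a\<close>. The mean value inequality for \<open>f\<close> minus its linearization at
  \<open>a\<close> multiplies this by another factor \<open>norm (b - a)\<close>.\<close>

lemma grad_diff_bigo:
  fixes f :: "real ^ 'n \<Rightarrow> real"
  assumes "\<And>x. f differentiable (at x)" "grad f differentiable (at a)" "x \<longlonglongrightarrow> a"
  shows "(\<lambda>k. f (x k) - f a - (x k - a) \<bullet> grad f a) \<in> O(\<lambda>k. norm (x k - a) ^ 2)"
proof -
  have d: "(grad f has_derivative (\<lambda>h. hess f a *v h)) (at a)"
    by (rule has_derivative_hess) fact
  from d obtain r where r: "r > 0"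
      "\<And>y. norm (y - a) < r \<Longrightarrow> norm (grad f y - grad f a - hess f a *v (y - a)) \<le> 1 * norm (y - a)"
    unfolding has_derivative_at_alt using zero_less_one by blast
  obtain L where L: "L > 0" "\<And>w. norm (hess f a *v w) \<le> norm w * L"
    using bounded_linear.pos_bounded[OF has_derivative_bounded_linear[OF d]] by blast
  have Lip: "norm (grad f y - grad f a) \<le> (1 + L) * norm (y - a)" if "norm (y - a) < r" for y
    using r(2)[OF that] L(2)[of "y - a"]
      norm_triangle_ineq[of "grad f y - grad f a - hess f a *v (y - a)" "hess f a *v (y - a)"]
    by (simp add: algebra_simps)
  \<comment> \<open>The closed ball of radius \<open>norm (b - a)\<close> contains the segment from
    \<open>a\<close> to \<open>b\<close>, and on it the derivative differs from that at
    \<open>a\<close> by at most \<open>(1 + L) * norm (b - a)\<close>.\<close>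
  have bound: "norm (f b - f a - (b - a) \<bullet> grad f a) \<le> norm (b - a) * ((1 + L) * norm (b - a))"
    if "norm (b - a) < r" for b
  proof -
    have S: "a + t *\<^sub>R (b - a) \<in> cball a (norm (b - a))" if "t \<in> {0..1}" for t
    proof -
      have "dist a (a + t *\<^sub>R (b - a)) = \<bar>t\<bar> * norm (b - a)"
        by (simp add: dist_norm)
      also have "\<dots> \<le> norm (b - a)" using that by (intro mult_left_le_one_le) auto
      finally show ?thesis by simp
    qed
    have f': "(f has_derivative (\<lambda>h. h \<bullet> grad f x)) (at x within cball a (norm (b - a)))" for x
      by (rule has_derivative_at_withinI, rule has_derivative_grad, rule assms)
    have B: "onorm ((\<lambda>h. h \<bullet> grad f x) - (\<lambda>h. h \<bullet> grad f a)) \<le> (1 + L) * norm (b - a)"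
      if "x \<in> cball a (norm (b - a))" for x
    proof (rule onorm_bound)
      have x: "norm (x - a) \<le> norm (b - a)" using that by (simp add: dist_norm norm_minus_commute)
      show "0 \<le> (1 + L) * norm (b - a)" using L(1) by simp
      fix h
      have "norm (((\<lambda>h. h \<bullet> grad f x) - (\<lambda>h. h \<bullet> grad f a)) h) \<le> norm h * norm (grad f x - grad f a)"
        using Cauchy_Schwarz_ineq2[of h "grad f x - grad f a"] by (simp add: inner_diff_right)
      also have "\<dots> \<le> norm h * ((1 + L) * norm (b - a))"
      proof (rule mult_left_mono)
        have "norm (grad f x - grad f a) \<le> (1 + L) * norm (x - a)"
          using x that(1) \<open>norm (b - a) < r\<close> by (intro Lip) simp
        also have "\<dots> \<le> (1 + L) * norm (b - a)"
          using x L(1) by (intro mult_left_mono) auto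
        finally show "norm (grad f x - grad f a) \<le> (1 + L) * norm (b - a)" .
      qed simp
      finally show "norm (((\<lambda>h. h \<bullet> grad f x) - (\<lambda>h. h \<bullet> grad f a)) h) \<le> (1 + L) * norm (b - a) * norm h"
        by (simp add: mult_ac)
    qed
    show ?thesis
      by (rule differentiable_bound_linearization[where f = f and f' = "\<lambda>x h. h \<bullet> grad f x"
            and a = a and b = b and ?x0.0 = a, OF S f' B]) auto
  qed
  have "eventually (\<lambda>k. norm (x k - a) < r) sequentially"
    using assms(3) r(1) by (auto simp: tendsto_iff dist_norm)
  then show ?thesis
    by (intro bigoI[of _ "1 + L"], elim eventually_mono)
      (use bound in \<open>auto simp: power2_eq_square mult_ac\<close>)
qed

section \<open>Landau calculus for norms and inner products of vectors\<close>

lemma inner_bigo: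
  fixes f g :: "'a \<Rightarrow> 'b :: real_inner"
  assumes "(\<lambda>k. norm (f k)) \<in> O[F](a)" "(\<lambda>k. norm (g k)) \<in> O[F](b)"
  shows "(\<lambda>k. f k \<bullet> g k) \<in> O[F](\<lambda>k. a k * b k)"
proof -
  have "(\<lambda>k. f k \<bullet> g k) \<in> O[F](\<lambda>k. norm (f k) * norm (g k))"
    by (rule landau_o.bigI[of 1]) (auto simp: Cauchy_Schwarz_ineq2)
  also have "(\<lambda>k. norm (f k) * norm (g k)) \<in> O[F](\<lambda>k. a k * b k)"
    by (intro landau_o.big.mult assms)
  finally show ?thesis .
qed

lemma inner_smallo:
  fixes f g :: "'a \<Rightarrow> 'b :: real_inner"
  assumes "(\<lambda>k. norm (f k)) \<in> O[F](a)" "(\<lambda>k. norm (g k)) \<in> o[F](b)"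
  shows "(\<lambda>k. f k \<bullet> g k) \<in> o[F](\<lambda>k. a k * b k)"
proof -
  have "(\<lambda>k. f k \<bullet> g k) \<in> O[F](\<lambda>k. norm (f k) * norm (g k))"
    by (rule landau_o.bigI[of 1]) (auto simp: Cauchy_Schwarz_ineq2)
  also have "(\<lambda>k. norm (f k) * norm (g k)) \<in> o[F](\<lambda>k. a k * b k)"
    by (intro landau_o.big_small_mult assms)
  finally show ?thesis .
qed

lemma norm_add_bigo:
  assumes "(\<lambda>k. norm (f k)) \<in> O[F](a :: _ \<Rightarrow> real)" "(\<lambda>k. norm (g k)) \<in> O[F](a)"
  shows "(\<lambda>k. norm (f k + g k)) \<in> O[F](a)"
proof -
  have "(\<lambda>k. norm (f k + g k)) \<in> O[F](\<lambda>k. norm (f k) + norm (g k))"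
    by (rule landau_o.bigI[of 1]) (auto simp: norm_triangle_ineq)
  also have "(\<lambda>k. norm (f k) + norm (g k)) \<in> O[F](a)" 
    by (intro sum_in_bigo assms)
  finally show ?thesis .
qed

lemma norm_sum_bigo:
  assumes "\<And>i. i \<in> I \<Longrightarrow> (\<lambda>k. norm (f i k)) \<in> O[F](a :: _ \<Rightarrow> real)"
  shows "(\<lambda>k. norm (\<Sum>i\<in>I. f i k)) \<in> O[F](a)"
proof -
  have "(\<lambda>k. norm (\<Sum>i\<in>I. f i k)) \<in> O[F](\<lambda>k. \<Sum>i\<in>I. norm (f i k))"
    by (rule landau_o.bigI[of 1]) (auto intro!: always_eventually norm_sum simp: abs_of_nonneg sum_nonneg)
  also have "(\<lambda>k. \<Sum>i\<in>I. norm (f i k)) \<in> O[F](a)" 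
    by (intro big_sum_in_bigo assms)
  finally show ?thesis .
qed


lemma has_derivative_bigo:
  assumes "(f has_derivative f') (at a)" "x \<longlonglongrightarrow> a"
  shows "(\<lambda>k. norm (f (x k) - f a)) \<in> O(\<lambda>k. norm (x k - a))"
proof -
  have "(\<lambda>k. norm (f (x k) - f a - f' (x k - a))) \<in> O(\<lambda>k. norm (x k - a))"
    by (rule landau_o.small_imp_big, rule has_derivative_smallo) fact+
  moreover obtain L where "\<And>w. norm (f' w) \<le> norm w * L"
    using bounded_linear.pos_bounded[OF has_derivative_bounded_linear[OF assms(1)]] by blast
  then have "(\<lambda>k. norm (f' (x k - a))) \<in> O(\<lambda>k. norm (x k - a))"
    by (intro bigoI[of _ L]) (simp add: mult_ac)
  ultimately have "(\<lambda>k. norm ((f (x k) - f a - f' (x k - a)) + f' (x k - a))) \<in> O(\<lambda>k. norm (x k - a))"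
    by (rule norm_add_bigo)
  then show ?thesis by simp
qed

lemma component_smallo_1:
  fixes f :: "nat \<Rightarrow> real ^ 'm"
  assumes "f \<longlonglongrightarrow> 0"
  shows "(\<lambda>k. f k $ i) \<in> o(\<lambda>_. 1)"
  using tendsto_vec_nth[OF assms, of i] by (intro smalloI_tendsto) auto

lemma norm_scaleR_bigo:
  assumes "(\<lambda>k. a k :: real) \<in> O[F](b)" "(\<lambda>k. norm (f k)) \<in> O[F](c)"
  shows "(\<lambda>k. norm (a k *\<^sub>R f k)) \<in> O[F](\<lambda>k. b k * c k)"
  using landau_o.big.mult[of "\<lambda>k. \<bar>a k\<bar>" _ b] assms by simp

section \<open>A sequence of central points approaching the solution set\<close>

text \<open>Working along one sequence turns every estimate into a Landau statement in
  \<open>k\<close>, so that constants and neighbourhoods need no explicit tracking.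
  \<open>lh\<close> is the strictly complementary multiplier.\<close>

locale central_sequence =
  fixes \<phi> :: "real ^ 'n \<Rightarrow> real" and g :: "real ^ 'n \<Rightarrow> real ^ 'm"
    and zs :: "real ^ 'n" and C \<gamma> :: real and lh :: "real ^ 'm"
    and z :: "nat \<Rightarrow> real ^ 'n" and l s :: "nat \<Rightarrow> real ^ 'm"
  assumes phi: "twice_Lipschitz_differentiable \<phi>"
    and g: "\<And>i. twice_Lipschitz_differentiable (\<lambda>z. g z $ i)"
    and mfcq: "mfcq g zs"
    and second_order: "second_order \<phi> g zs"
    and lh: "lh \<in> multipliers \<phi> g zs"
    and lh_pos: "\<And>i. i \<in> active g zs \<Longrightarrow> 0 < lh $ i"
    and \<gamma>: "\<gamma> > 0"
    and cent: "\<And>k. centrality \<phi> g C \<gamma> (z k) (l k) (s k)"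
    and dist_tendsto: "(\<lambda>k. sol_dist \<phi> g zs (z k) (l k)) \<longlonglongrightarrow> 0"
    and gap_tendsto: "(\<lambda>k. compl_gap (l k) (s k)) \<longlonglongrightarrow> 0"
begin

abbreviation "F \<equiv> grad \<phi>"
abbreviation "G i \<equiv> grad (\<lambda>x. g x $ i)"
abbreviation "B \<equiv> active g zs"
abbreviation "S \<equiv> multipliers \<phi> g zs"
abbreviation "d k \<equiv> norm (z k - zs)"
abbreviation "\<mu> k \<equiv> compl_gap (l k) (s k)"

lemma phi_diff: "\<phi> differentiable (at x)" and F_diff: "F differentiable (at x)"
  using phi by (auto simp: twice_Lipschitz_differentiable_def)

lemma g_diff: "(\<lambda>x. g x $ i) differentiable (at x)" and G_diff: "G i differentiable (at x)"
  using g[of i] by (auto simp: twice_Lipschitz_differentiable_def)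

lemma lagr_grad: "lagr_grad \<phi> g x v = F x + (\<Sum>i\<in>UNIV. v $ i *\<^sub>R G i x)"
  by (rule lagr_grad_eq[OF phi_diff g_diff])

lemma lagr_hess: "lagr_hess \<phi> g x v *v w =
    hess \<phi> x *v w + (\<Sum>i\<in>UNIV. v $ i *\<^sub>R (hess (\<lambda>y. g y $ i) x *v w))"
  by (rule lagr_hess_mult_eq[OF phi_diff g_diff F_diff G_diff])

lemma g_zs_nonpos: "g zs $ i \<le> 0"
  using lh by (simp add: multipliers_def kkt_def)

lemma g_zs_neg: "i \<notin> B \<Longrightarrow> g zs $ i < 0"
  using g_zs_nonpos[of i] by (simp add: active_def)

text \<open>Since \<open>v \<ge> 0\<close> and \<open>g zs \<le> 0\<close>, all summands of
  \<open>v \<bullet> g zs\<close> have one sign, so complementarity holds termwise. \<open>S\<close>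
  thus becomes a polyhedron: affine equations plus nonnegativity.\<close>

lemma mem_S_iff:
  "v \<in> S \<longleftrightarrow> F zs + (\<Sum>i\<in>UNIV. v $ i *\<^sub>R G i zs) = 0 \<and> (\<forall>i. 0 \<le> v $ i) \<and> (\<forall>i. i \<notin> B \<longrightarrow> v $ i = 0)"
proof -
  have "(v \<bullet> g zs = 0) \<longleftrightarrow> (\<forall>i. i \<notin> B \<longrightarrow> v $ i = 0)" if "\<forall>i. 0 \<le> v $ i"
  proof -
    have "(\<Sum>i\<in>UNIV. - (v $ i * g zs $ i)) = 0 \<longleftrightarrow> (\<forall>i\<in>UNIV. - (v $ i * g zs $ i) = 0)"
      using that g_zs_nonpos by (intro sum_nonneg_eq_0_iff) (auto intro: mult_nonneg_nonpos)
    then show ?thesis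
      by (auto simp: inner_vec_def sum_negf active_def)
  qed
  then show ?thesis
    using g_zs_nonpos by (auto simp: multipliers_def kkt_def lagr_grad)
qed

text \<open>Pairing the stationarity equation with an MFCQ direction \<open>y\<close> leaves a sum
  of nonnegative terms \<open>v_j * - (G_j \<bullet> y)\<close> with the fixed total
  \<open>F zs \<bullet> y\<close>, so each active multiplier is bounded.\<close>

lemma S_bounded: obtains M where "M > 0" "\<And>v i. v \<in> S \<Longrightarrow> \<bar>v $ i\<bar> \<le> M"
proof -
  obtain y where y: "\<And>i. i \<in> B \<Longrightarrow> G i zs \<bullet> y < 0"
    using mfcq by (auto simp: mfcq_def)
  define M where "M = (\<Sum>j\<in>B. \<bar>F zs \<bullet> y\<bar> / - (G j zs \<bullet> y))"
  have nonneg: "0 \<le> \<bar>F zs \<bullet> y\<bar> / - (G j zs \<bullet> y)" if "j \<in> B" for j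
    using y[OF that] by (simp add: divide_nonneg_neg)
  have M: "M \<ge> 0" unfolding M_def by (intro sum_nonneg nonneg)
  \<comment> \<open>\<open>M\<close> is zero when \<open>B\<close> is empty; adding 1 makes the
    bound strictly positive.\<close>
  have "\<bar>v $ i\<bar> \<le> M + 1" if v: "v \<in> S" for v i
  proof (cases "i \<in> B")
    case True
    from v have eq: "F zs + (\<Sum>j\<in>UNIV. v $ j *\<^sub>R G j zs) = 0" and pos: "\<And>i. 0 \<le> v $ i"
      and zero: "\<And>i. i \<notin> B \<Longrightarrow> v $ i = 0" by (auto simp: mem_S_iff)
    have "(\<Sum>j\<in>UNIV. v $ j *\<^sub>R G j zs) = - F zs"
      using eq by (simp add: eq_neg_iff_add_eq_0 add.commute)
    then have "(\<Sum>j\<in>UNIV. v $ j * (G j zs \<bullet> y)) = - (F zs \<bullet> y)"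
      by (metis (no_types, lifting) inner_minus_left inner_scaleR_left inner_sum_left sum.cong)
    then have sum: "(\<Sum>j\<in>UNIV. v $ j * - (G j zs \<bullet> y)) = F zs \<bullet> y"
      by (simp add: sum_negf)
    have term_nonneg: "0 \<le> v $ j * - (G j zs \<bullet> y)" for j
    proof (cases "j \<in> B")
      case True
      then show ?thesis using pos[of j] y[of j] by (intro mult_nonneg_nonneg) auto
    qed (simp add: zero)
    have "v $ i * - (G i zs \<bullet> y) \<le> (\<Sum>j\<in>UNIV. v $ j * - (G j zs \<bullet> y))"
      by (intro member_le_sum term_nonneg) auto
    also have "\<dots> \<le> \<bar>F zs \<bullet> y\<bar>" unfolding sum by simp
    finally have "v $ i \<le> \<bar>F zs \<bullet> y\<bar> / - (G i zs \<bullet> y)"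
      using y[OF True] by (simp add: field_simps)
    also have "\<dots> \<le> M" unfolding M_def
      using True nonneg by (intro member_le_sum) auto
    finally show ?thesis using pos[of i] by simp
  next
    case False
    then show ?thesis using v M by (auto simp: mem_S_iff)
  qed
  then show ?thesis using M by (intro that[of "M + 1"]) auto
qed

section \<open>Direct consequences of centrality\<close>

lemma l_pos: "0 < l k $ i" and s_pos: "0 < s k $ i" and l_s_ge: "\<gamma> * \<mu> k \<le> l k $ i * s k $ i"
  using cent[of k] by (auto simp: centrality_def)

lemma inner_l_s: "l k \<bullet> s k = real CARD('m) * \<mu> k"
  by (simp add: compl_gap_def)

lemma mu_pos: "0 < \<mu> k"
  unfolding compl_gap_def inner_vec_def using l_pos s_pos
  by (intro divide_pos_pos sum_pos) auto

lemma sum_l_s_le: "(\<Sum>i\<in>I. l k $ i * s k $ i) \<le> real CARD('m) * \<mu> k"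
  unfolding inner_l_s[symmetric] inner_vec_def inner_real_def
  by (intro sum_mono2) (auto intro: mult_nonneg_nonneg less_imp_le[OF l_pos] less_imp_le[OF s_pos])

lemma l_s_le: "l k $ i * s k $ i \<le> real CARD('m) * \<mu> k"
  using sum_l_s_le[of k "{i}"] by simp

lemma ex_near_multipliers:
  obtains ls where "\<And>k. ls k \<in> S" "(\<lambda>k. l k - ls k) \<longlonglongrightarrow> 0" "z \<longlonglongrightarrow> zs"
proof -
  \<comment> \<open>The slack \<open>\<mu> k > 0\<close> lets a multiplier almost attain the infimum
    in \<open>sol_dist\<close>, and it vanishes in the limit.\<close>
  have "\<exists>v\<in>S. dist (z k, l k) (zs, v) < sol_dist \<phi> g zs (z k) (l k) + \<mu> k" for k
  proof -
    have ne: "{zs} \<times> S \<noteq> {}" using lh by auto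
    have "infdist (z k, l k) ({zs} \<times> S) < sol_dist \<phi> g zs (z k) (l k) + \<mu> k"
      using mu_pos[of k] by (simp add: sol_dist_def)
    then obtain p where "p \<in> {zs} \<times> S" "dist (z k, l k) p < sol_dist \<phi> g zs (z k) (l k) + \<mu> k"
      unfolding infdist_notempty[OF ne] using ne by (subst (asm) cINF_less_iff) auto
    then show ?thesis by auto
  qed
  then obtain ls where ls: "\<And>k. ls k \<in> S"
    "\<And>k. dist (z k, l k) (zs, ls k) < sol_dist \<phi> g zs (z k) (l k) + \<mu> k" by metis
  have lim: "(\<lambda>k. sol_dist \<phi> g zs (z k) (l k) + \<mu> k) \<longlonglongrightarrow> 0"
    using tendsto_add[OF dist_tendsto gap_tendsto] by simp
  have "(\<lambda>k. l k - ls k) \<longlonglongrightarrow> 0"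
  proof (rule Lim_null_comparison[OF always_eventually lim], intro allI)
    show "norm (l k - ls k) \<le> sol_dist \<phi> g zs (z k) (l k) + \<mu> k" for k
      using ls(2)[of k] dist_snd_le[of "(z k, l k)" "(zs, ls k)"] by (simp add: dist_norm)
  qed
  moreover have "(\<lambda>k. z k - zs) \<longlonglongrightarrow> 0"
  proof (rule Lim_null_comparison[OF always_eventually lim], intro allI)
    show "norm (z k - zs) \<le> sol_dist \<phi> g zs (z k) (l k) + \<mu> k" for k
      using ls(2)[of k] dist_fst_le[of "(z k, l k)" "(zs, ls k)"] by (simp add: dist_norm)
  qed
  ultimately show ?thesis using ls(1) by (intro that) (auto simp: LIM_zero_iff)
qed

lemma z_tendsto: "z \<longlonglongrightarrow> zs"
  using ex_near_multipliers by blast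

lemma d_tendsto: "d \<longlonglongrightarrow> 0"
  using z_tendsto by (simp add: LIM_zero_iff tendsto_norm_zero_iff)

lemma eventually_d_le: "c > 0 \<Longrightarrow> eventually (\<lambda>k. d k \<le> c) sequentially"
  using order_tendstoD(2)[OF d_tendsto, of c] by (auto elim: eventually_mono)

lemma eventually_mu_le: "c > 0 \<Longrightarrow> eventually (\<lambda>k. \<mu> k \<le> c) sequentially"
  using order_tendstoD(2)[OF gap_tendsto, of c] by (auto elim: eventually_mono)

lemma near_bigo_1:
  assumes "eventually (\<lambda>k. ls k \<in> S) sequentially"
  shows "(\<lambda>k. ls k $ i) \<in> O(\<lambda>_. 1)"
proof -
  obtain M where "M > 0" "\<And>v i. v \<in> S \<Longrightarrow> \<bar>v $ i\<bar> \<le> M" using S_bounded by metis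
  with assms show ?thesis by (intro bigoI[of _ M]) (auto elim: eventually_mono)
qed

lemma l_bigo_1: "(\<lambda>k. l k $ i) \<in> O(\<lambda>_. 1)"
proof -
  obtain ls where ls: "\<And>k. ls k \<in> S" "(\<lambda>k. l k - ls k) \<longlonglongrightarrow> 0" using ex_near_multipliers by blast
  have "(\<lambda>k. (l k - ls k) $ i + ls k $ i) \<in> O(\<lambda>_. 1)"
    using ls by (intro sum_in_bigo near_bigo_1 landau_o.small_imp_big[OF component_smallo_1] always_eventually) auto
  then show ?thesis by simp
qed

lemma g_s_le: "\<bar>g (z k) $ i + s k $ i\<bar> \<le> C * \<mu> k"
  using cent[of k] component_le_norm_cart[of "g (z k) + s k" i] by (auto simp: centrality_def)

lemma g_s_bigo: "(\<lambda>k. g (z k) $ i + s k $ i) \<in> O(\<mu>)"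
  using g_s_le mu_pos by (intro bigoI[of _ C]) (auto simp: less_imp_le abs_of_pos)

lemma lagr_grad_bigo: "(\<lambda>k. norm (lagr_grad \<phi> g (z k) (l k))) \<in> O(\<mu>)"
  using cent mu_pos by (intro bigoI[of _ C]) (auto simp: centrality_def abs_of_pos)

lemma s_tendsto: "(\<lambda>k. s k $ i) \<longlonglongrightarrow> - g zs $ i"
proof -
  have 1: "(\<lambda>k. g (z k) $ i) \<longlonglongrightarrow> g zs $ i"
    using isCont_tendsto_compose[OF differentiable_imp_continuous_within[OF g_diff] z_tendsto] .
  have "(\<lambda>k. C * \<mu> k) \<longlonglongrightarrow> 0"
    using tendsto_mult_right_zero[OF gap_tendsto] .
  then have "(\<lambda>k. g (z k) $ i + s k $ i) \<longlonglongrightarrow> 0"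
    by (rule Lim_null_comparison[rotated]) (use g_s_le in auto)
  from tendsto_diff[OF this 1] show ?thesis by simp
qed

text \<open>The slack of an inactive constraint converges to \<open>- g zs $ i > 0\<close>, so it
  eventually exceeds half that limit, and the bound on the product \<open>l_i s_i\<close> passes to
  \<open>l_i\<close>.\<close>

lemma l_inactive_bigo:
  assumes "i \<notin> B" shows "(\<lambda>k. l k $ i) \<in> O(\<mu>)"
proof -
  define c where "c = - g zs $ i / 2"
  have c: "c > 0" using g_zs_neg[OF assms] by (simp add: c_def)
  have "eventually (\<lambda>k. c < s k $ i) sequentially"
    using c by (intro order_tendstoD(1)[OF s_tendsto]) (simp add: c_def)
  then have "eventually (\<lambda>k. norm (l k $ i) \<le> real CARD('m) / c * norm (\<mu> k)) sequentially"
  proof eventually_elim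
    case (elim k)
    have "l k $ i * c \<le> l k $ i * s k $ i"
      using l_pos[of k i] elim by (intro mult_left_mono) auto
    also have "\<dots> \<le> real CARD('m) * \<mu> k" by (rule l_s_le)
    finally show ?case using c l_pos[of k i] mu_pos[of k] by (simp add: field_simps)
  qed
  then show ?thesis by (rule bigoI)
qed

section \<open>Expansions at the solution and the size of the active slacks\<close>

lemma g_taylor: "(\<lambda>k. g (z k) $ i - g zs $ i - (z k - zs) \<bullet> G i zs) \<in> O(\<lambda>k. d k ^ 2)"
  by (rule grad_diff_bigo[OF g_diff G_diff z_tendsto])

lemma F_diff_bigo: "(\<lambda>k. norm (F (z k) - F zs)) \<in> O(d)"
  by (rule has_derivative_bigo[OF has_derivative_hess[OF F_diff] z_tendsto])

lemma G_diff_bigo: "(\<lambda>k. norm (G i (z k) - G i zs)) \<in> O(d)"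
  by (rule has_derivative_bigo[OF has_derivative_hess[OF G_diff] z_tendsto])

lemma bigo_plus: "\<mu> \<in> O(\<lambda>k. \<mu> k + d k)" "d \<in> O(\<lambda>k. \<mu> k + d k)"
  "\<mu> \<in> O(\<lambda>k. \<mu> k + d k ^ 2)" "(\<lambda>k. d k ^ 2) \<in> O(\<lambda>k. \<mu> k + d k ^ 2)"
  using mu_pos by (auto intro!: bigoI[of _ 1] always_eventually simp: less_imp_le abs_of_pos add_pos_nonneg)

text \<open>Stationarity holds at \<open>z k\<close> up to \<open>C * \<mu> k\<close>; moving the
  gradients from \<open>z k\<close> to \<open>zs\<close> costs \<open>O(d)\<close> because the
  multipliers are bounded.\<close>

lemma residual_bigo:
  "(\<lambda>k. norm (F zs + (\<Sum>i\<in>UNIV. l k $ i *\<^sub>R G i zs))) \<in> O(\<lambda>k. \<mu> k + d k)"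
proof -
  have eq: "F zs + (\<Sum>i\<in>UNIV. l k $ i *\<^sub>R G i zs) = lagr_grad \<phi> g (z k) (l k) +
      ((F zs - F (z k)) + (\<Sum>i\<in>UNIV. l k $ i *\<^sub>R (G i zs - G i (z k))))" for k
    by (simp add: lagr_grad algebra_simps sum_subtractf)
  have F: "(\<lambda>k. norm (F zs - F (z k))) \<in> O(\<lambda>k. \<mu> k + d k)"
    using landau_o.big_trans[OF F_diff_bigo bigo_plus(2)] by (simp add: norm_minus_commute)
  have G: "(\<lambda>k. norm (l k $ i *\<^sub>R (G i zs - G i (z k)))) \<in> O(\<lambda>k. \<mu> k + d k)" for i
  proof -
    have "(\<lambda>k. norm (G i zs - G i (z k))) \<in> O(d)"
      using G_diff_bigo[of i] by (simp add: norm_minus_commute)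
    from norm_scaleR_bigo[OF l_bigo_1 this]
    have "(\<lambda>k. norm (l k $ i *\<^sub>R (G i zs - G i (z k)))) \<in> O(d)" by (simp only: mult_1)
    then show ?thesis using bigo_plus(2) by (rule landau_o.big_trans)
  qed
  show ?thesis unfolding eq
    by (intro norm_add_bigo norm_sum_bigo F G landau_o.big_trans[OF lagr_grad_bigo bigo_plus(1)])
qed

lemma sum_residual:
  assumes "v \<in> S"
  shows "(\<Sum>i\<in>UNIV. (w $ i - v $ i) *\<^sub>R G i zs) = F zs + (\<Sum>i\<in>UNIV. w $ i *\<^sub>R G i zs)"
proof -
  have "F zs + (\<Sum>i\<in>UNIV. v $ i *\<^sub>R G i zs) = 0" using assms by (simp add: mem_S_iff)
  then have "(\<Sum>i\<in>UNIV. v $ i *\<^sub>R G i zs) = - F zs" by (simp add: eq_neg_iff_add_eq_0 add.commute)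
  then show ?thesis by (simp add: scaleR_left_diff_distrib sum_subtractf)
qed

text \<open>On \<open>B\<close> the slack is minus the linearized constraint up to
  \<open>O(\<mu> + d^2)\<close>. Weighting with \<open>l - lh\<close> turns the linearized part into
  \<open>\<Delta>\<close> times the stationarity residual, which is \<open>O(d (\<mu> + d))\<close>.
  Hence \<open>\<Sum> lh_j s_j\<close> differs from \<open>\<Sum> l_j s_j = O(\<mu>)\<close> by
  \<open>O(\<mu> + d^2)\<close>, and strict complementarity isolates each slack.\<close>

lemma s_active_bigo:
  assumes i: "i \<in> B"
  shows "(\<lambda>k. s k $ i) \<in> O(\<lambda>k. \<mu> k + d k ^ 2)"
proof -
  let ?r = "\<lambda>k. \<mu> k + d k ^ 2"
  define \<Delta> where "\<Delta> k = z k - zs" for k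
  define T where "T j k = g (z k) $ j - g zs $ j - \<Delta> k \<bullet> G j zs" for j k
  have T: "T j \<in> O(?r)" for j
    using landau_o.big_trans[OF g_taylor bigo_plus(4)] by (simp add: T_def[abs_def] \<Delta>_def)
  have lmlh: "(\<lambda>k. l k $ j - lh $ j) \<in> O(\<lambda>_. 1)" for j
    by (intro sum_in_bigo l_bigo_1) simp
  have mult1: "(\<lambda>k. f k * h k) \<in> O(?r)" if "f \<in> O(\<lambda>_. 1)" "h \<in> O(?r)" for f h
    using landau_o.big.mult[OF that] by simp
  have dr: "(\<lambda>k. d k * (\<mu> k + d k)) \<in> O(?r)"
  proof (rule bigoI[of _ 1])
    show "eventually (\<lambda>k. norm (d k * (\<mu> k + d k)) \<le> 1 * norm (?r k)) sequentially"
      using eventually_d_le[OF zero_less_one]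
    proof eventually_elim
      case (elim k)
      have "d k * \<mu> k \<le> 1 * \<mu> k" using elim mu_pos[of k] by (intro mult_right_mono) auto
      then show ?case using mu_pos[of k]
        by (simp add: algebra_simps power2_eq_square abs_of_nonneg)
    qed
  qed
  have G: "(\<lambda>k. \<Delta> k \<bullet> (\<Sum>j\<in>B. (l k $ j - lh $ j) *\<^sub>R G j zs)) \<in> O(?r)"
  proof -
    \<comment> \<open>The sum over all indices is the stationarity residual, since \<open>lh\<close>
      is stationary. The inactive part to be removed involves only \<open>l_j = O(\<mu>)\<close>, as
      \<open>lh\<close> vanishes there.\<close>
    have eq: "(\<Sum>j\<in>B. (l k $ j - lh $ j) *\<^sub>R G j zs) =
        (F zs + (\<Sum>j\<in>UNIV. l k $ j *\<^sub>R G j zs)) + (\<Sum>j\<in>-B. l k $ j *\<^sub>R (- G j zs))" for k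
    proof -
      have "(\<Sum>j\<in>UNIV. (l k $ j - lh $ j) *\<^sub>R G j zs) =
          (\<Sum>j\<in>B. (l k $ j - lh $ j) *\<^sub>R G j zs) + (\<Sum>j\<in>-B. (l k $ j - lh $ j) *\<^sub>R G j zs)"
        by (subst sum.union_disjoint[symmetric]) auto
      also have "(\<Sum>j\<in>-B. (l k $ j - lh $ j) *\<^sub>R G j zs) = (\<Sum>j\<in>-B. l k $ j *\<^sub>R G j zs)"
        using lh by (intro sum.cong) (auto simp: mem_S_iff)
      finally show ?thesis unfolding sum_residual[OF lh] by (simp add: sum_negf)
    qed
    have "(\<lambda>k. norm (l k $ j *\<^sub>R (- G j zs))) \<in> O(\<lambda>k. \<mu> k + d k)" if "j \<notin> B" for j
      using landau_o.big_trans[OF norm_scaleR_bigo[OF l_inactive_bigo[OF that], of "\<lambda>_. - G j zs" "\<lambda>_. 1"]]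
        bigo_plus(1) by simp
    then have "(\<lambda>k. norm (\<Sum>j\<in>B. (l k $ j - lh $ j) *\<^sub>R G j zs)) \<in> O(\<lambda>k. \<mu> k + d k)"
      unfolding eq by (intro norm_add_bigo residual_bigo norm_sum_bigo) auto
    then have "(\<lambda>k. \<Delta> k \<bullet> (\<Sum>j\<in>B. (l k $ j - lh $ j) *\<^sub>R G j zs)) \<in> O(\<lambda>k. d k * (\<mu> k + d k))"
      by (intro inner_bigo) (simp_all add: \<Delta>_def)
    then show ?thesis using dr by (rule landau_o.big_trans)
  qed
  have ls: "(\<lambda>k. \<Sum>j\<in>B. l k $ j * s k $ j) \<in> O(?r)"
  proof (rule landau_o.big_trans[OF _ bigo_plus(3)], rule bigoI[of _ "real CARD('m)"], rule always_eventually, rule allI)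
    fix k
    have "0 \<le> (\<Sum>j\<in>B. l k $ j * s k $ j)"
      using l_pos s_pos by (intro sum_nonneg mult_nonneg_nonneg) (auto intro: less_imp_le)
    then show "norm (\<Sum>j\<in>B. l k $ j * s k $ j) \<le> real CARD('m) * norm (\<mu> k)"
      using sum_l_s_le[of k B] mu_pos[of k] by simp
  qed
  \<comment> \<open>In \<open>lh_j s_j = l_j s_j - (l_j - lh_j) s_j\<close>, substitute
    \<open>s_j = (g_j + s_j) - T_j - \<Delta> \<bullet> G_j\<close> in the last factor; this is
    valid on \<open>B\<close>, where \<open>g zs\<close> vanishes.\<close>
  have eq: "(\<Sum>j\<in>B. lh $ j * s k $ j) = (\<Sum>j\<in>B. l k $ j * s k $ j)
      - (\<Sum>j\<in>B. (l k $ j - lh $ j) * (g (z k) $ j + s k $ j))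
      + (\<Sum>j\<in>B. (l k $ j - lh $ j) * T j k)
      + \<Delta> k \<bullet> (\<Sum>j\<in>B. (l k $ j - lh $ j) *\<^sub>R G j zs)" for k
  proof -
    have "lh $ j * s k $ j = l k $ j * s k $ j - (l k $ j - lh $ j) * (g (z k) $ j + s k $ j)
      + (l k $ j - lh $ j) * T j k + \<Delta> k \<bullet> ((l k $ j - lh $ j) *\<^sub>R G j zs)" if "j \<in> B" for j
      using that by (simp add: T_def active_def algebra_simps)
    then show ?thesis
      by (simp add: inner_sum_right sum.distrib sum_subtractf)
  qed
  have "(\<lambda>k. \<Sum>j\<in>B. lh $ j * s k $ j) \<in> O(?r)"
    unfolding eq
    by (intro sum_in_bigo(1)[OF sum_in_bigo(1)[OF sum_in_bigo(2)]] ls G big_sum_in_bigo mult1 lmlh T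
        landau_o.big_trans[OF g_s_bigo bigo_plus(3)])
  moreover have "(\<lambda>k. s k $ i) \<in> O(\<lambda>k. \<Sum>j\<in>B. lh $ j * s k $ j)"
  proof (rule bigoI[of _ "1 / lh $ i"], rule always_eventually, rule allI)
    fix k
    have nn: "0 \<le> lh $ j * s k $ j" if "j \<in> B" for j
      using lh_pos[OF that] s_pos[of k j] by simp
    have "lh $ i * s k $ i \<le> (\<Sum>j\<in>B. lh $ j * s k $ j)"
      using i nn by (intro member_le_sum) auto
    then show "norm (s k $ i) \<le> 1 / lh $ i * norm (\<Sum>j\<in>B. lh $ j * s k $ j)"
      using lh_pos[OF i] s_pos[of k i] sum_nonneg[of B "\<lambda>j. lh $ j * s k $ j"] nn
      by (simp add: field_simps)
  qed
  ultimately show ?thesis by (rule landau_o.big_trans[rotated])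
qed

section \<open>Second-order expansion and quadratic growth\<close>

text \<open>Expand \<open>\<Delta> \<bullet> lagr_grad\<close> at \<open>(z, l)\<close> around
  \<open>(zs, ls)\<close>. Stationarity of \<open>ls\<close> removes the first-order terms,
  centrality makes the left side \<open>O(d \<mu>)\<close> (this is \<open>R1\<close>), and
  \<open>R2\<close> gathers the Taylor errors.\<close>

lemma quadratic_form_identity:
  assumes S: "eventually (\<lambda>k. ls k \<in> S) sequentially" and lim: "(\<lambda>k. l k - ls k) \<longlonglongrightarrow> 0"
  obtains R1 R2 where "R1 \<in> O(\<lambda>k. d k * \<mu> k)" "R2 \<in> o(\<lambda>k. d k ^ 2)"
    "eventually (\<lambda>k. (z k - zs) \<bullet> (lagr_hess \<phi> g zs (ls k) *v (z k - zs)) =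
       - (\<Sum>i\<in>UNIV. (l k - ls k) $ i * (g (z k) $ i - g zs $ i)) + R1 k + R2 k) sequentially"
proof -
  define \<Delta> where "\<Delta> k = z k - zs" for k
  define T where "T j k = g (z k) $ j - g zs $ j - \<Delta> k \<bullet> G j zs" for j k
  define E0 where "E0 k = F (z k) - F zs - hess \<phi> zs *v \<Delta> k" for k
  define E where "E i k = G i (z k) - G i zs - hess (\<lambda>x. g x $ i) zs *v \<Delta> k" for i k
  define E1 where "E1 k = E0 k + (\<Sum>i\<in>UNIV. ls k $ i *\<^sub>R E i k)" for k
  define R1 where "R1 k = \<Delta> k \<bullet> lagr_grad \<phi> g (z k) (l k)" for k
  \<comment> \<open>\<open>W i\<close> equals \<open>\<Delta> \<bullet> G i (z k)\<close> minus the
    increment of \<open>g_i\<close>, written as a difference of two terms that are each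
    \<open>O(d^2)\<close>.\<close>
  define W where "W i k = \<Delta> k \<bullet> (G i (z k) - G i zs) - T i k" for i k
  define R2 where "R2 k = - (\<Delta> k \<bullet> E0 k) - (\<Sum>i\<in>UNIV. ls k $ i * (\<Delta> k \<bullet> E i k))
    - (\<Sum>i\<in>UNIV. (l k - ls k) $ i * W i k)" for k
  have \<Delta>: "(\<lambda>k. norm (\<Delta> k)) \<in> O(d)" by (simp add: \<Delta>_def)
  have E0: "(\<lambda>k. \<Delta> k \<bullet> E0 k) \<in> o(\<lambda>k. d k * d k)"
    using has_derivative_smallo[OF has_derivative_hess[OF F_diff] z_tendsto] \<Delta>
    by (intro inner_smallo) (simp_all add: E0_def \<Delta>_def)
  have E: "(\<lambda>k. \<Delta> k \<bullet> E i k) \<in> o(\<lambda>k. d k * d k)" for i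
    using has_derivative_smallo[OF has_derivative_hess[OF G_diff] z_tendsto] \<Delta>
    by (intro inner_smallo) (simp_all add: E_def \<Delta>_def)
  have W: "W i \<in> O(\<lambda>k. d k * d k)" for i
  proof -
    have "T i \<in> O(\<lambda>k. d k * d k)"
      using g_taylor[of i] by (simp add: T_def[abs_def] \<Delta>_def power2_eq_square)
    then show ?thesis
      unfolding W_def[abs_def] by (intro sum_in_bigo(2) inner_bigo[OF \<Delta> G_diff_bigo])
  qed
  have "R1 \<in> O(\<lambda>k. d k * \<mu> k)"
    unfolding R1_def by (intro inner_bigo \<Delta> lagr_grad_bigo)
  moreover have "R2 \<in> o(\<lambda>k. d k * d k)"
  proof -
    have 1: "(\<lambda>k. ls k $ i * (\<Delta> k \<bullet> E i k)) \<in> o(\<lambda>k. d k * d k)" for i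
      using landau_o.big_small_mult[OF near_bigo_1[OF S] E] by simp
    \<comment> \<open>Only here does \<open>l - ls\<close> have to vanish: it improves
      \<open>O(d^2)\<close> to \<open>o(d^2)\<close>.\<close>
    have 2: "(\<lambda>k. (l k - ls k) $ i * W i k) \<in> o(\<lambda>k. d k * d k)" for i
      using landau_o.small_big_mult[OF component_smallo_1[OF lim] W] by simp
    show ?thesis
      unfolding R2_def by (intro sum_in_smallo big_sum_in_smallo 1 2) (use E0 in simp)
  qed
  moreover have "eventually (\<lambda>k. \<Delta> k \<bullet> (lagr_hess \<phi> g zs (ls k) *v \<Delta> k) =
       - (\<Sum>i\<in>UNIV. (l k - ls k) $ i * (g (z k) $ i - g zs $ i)) + R1 k + R2 k) sequentially"
    using S
  proof eventually_elim
    case (elim k)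
    have stat: "\<Delta> k \<bullet> F zs + (\<Sum>i\<in>UNIV. ls k $ i * (\<Delta> k \<bullet> G i zs)) = 0"
    proof -
      have "\<Delta> k \<bullet> (F zs + (\<Sum>i\<in>UNIV. ls k $ i *\<^sub>R G i zs)) = 0" using elim by (simp add: mem_S_iff)
      then show ?thesis by (simp add: inner_add_right inner_sum_right)
    qed
    let ?g = "\<lambda>i. g (z k) $ i - g zs $ i"
    have h: "\<Delta> k \<bullet> (lagr_hess \<phi> g zs (ls k) *v \<Delta> k) =
        \<Delta> k \<bullet> F (z k) - \<Delta> k \<bullet> F zs - \<Delta> k \<bullet> E0 k
        + (\<Sum>i\<in>UNIV. ls k $ i * (\<Delta> k \<bullet> G i (z k) - \<Delta> k \<bullet> G i zs - \<Delta> k \<bullet> E i k))"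
      by (simp add: lagr_hess inner_add_right inner_sum_right E0_def E_def inner_diff_right)
    have r1: "R1 k = \<Delta> k \<bullet> F (z k) + (\<Sum>i\<in>UNIV. l k $ i * (\<Delta> k \<bullet> G i (z k)))"
      by (simp add: R1_def lagr_grad inner_add_right inner_sum_right)
    have W: "W i k = \<Delta> k \<bullet> G i (z k) - ?g i" for i
      by (simp add: W_def T_def inner_diff_right)
    show ?case
      unfolding h r1 R2_def W using stat
      by (simp add: algebra_simps sum.distrib sum_subtractf)
  qed
  ultimately show ?thesis by (intro that) (simp_all add: \<Delta>_def power2_eq_square)
qed

text \<open>The Hessian is affine in the multiplier and \<open>S\<close> is bounded, so one constant
  serves all multipliers.\<close>

lemma lagr_hess_bounded:
  obtains M where "M > 0" "\<And>v w. v \<in> S \<Longrightarrow> norm (lagr_hess \<phi> g zs v *v w) \<le> M * norm w"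
proof -
  obtain L where L: "L > 0" "\<And>v i. v \<in> S \<Longrightarrow> \<bar>v $ i\<bar> \<le> L" using S_bounded by metis
  define N0 where "N0 = onorm (\<lambda>w. hess \<phi> zs *v w)"
  define N where "N i = onorm (\<lambda>w. hess (\<lambda>x. g x $ i) zs *v w)" for i
  have N0: "norm (hess \<phi> zs *v w) \<le> N0 * norm w" for w
    unfolding N0_def by (rule onorm) (rule matrix_vector_mul_bounded_linear)
  have N: "norm (hess (\<lambda>x. g x $ i) zs *v w) \<le> N i * norm w" for i w
    unfolding N_def by (rule onorm) (rule matrix_vector_mul_bounded_linear)
  have N0_nn: "0 \<le> N0" unfolding N0_def by (rule onorm_pos_le) (rule matrix_vector_mul_bounded_linear)
  have N_nn: "0 \<le> N i" for i unfolding N_def by (rule onorm_pos_le) (rule matrix_vector_mul_bounded_linear)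
  define M where "M = N0 + (\<Sum>i\<in>UNIV. L * N i) + 1"
  have "norm (lagr_hess \<phi> g zs v *v w) \<le> M * norm w" if "v \<in> S" for v w
  proof -
    have "norm (lagr_hess \<phi> g zs v *v w) \<le>
        norm (hess \<phi> zs *v w) + (\<Sum>i\<in>UNIV. \<bar>v $ i\<bar> * norm (hess (\<lambda>x. g x $ i) zs *v w))"
      unfolding lagr_hess
      by (rule order_trans[OF norm_triangle_ineq])
        (intro add_left_mono order_trans[OF norm_sum], simp)
    also have "\<dots> \<le> N0 * norm w + (\<Sum>i\<in>UNIV. L * (N i * norm w))"
      using L that by (intro add_mono N0 sum_mono mult_mono N) auto
    also have "\<dots> = (N0 + (\<Sum>i\<in>UNIV. L * N i)) * norm w"
      by (simp add: algebra_simps sum_distrib_left)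
    also have "\<dots> \<le> M * norm w" unfolding M_def by (intro mult_right_mono) auto
    finally show ?thesis .
  qed
  moreover have "M > 0" unfolding M_def
    using N0_nn L(1) N_nn by (auto intro!: add_nonneg_pos add_nonneg_nonneg sum_nonneg)
  ultimately show ?thesis using that by blast
qed


text \<open>Split \<open>\<Delta> = u + v\<close> with \<open>u\<close> orthogonal to all active
  gradients and \<open>v\<close> controlled by the products
  \<open>\<Delta> \<bullet> G i zs\<close>. The second-order condition handles \<open>u\<close>,
  while smallness of the active slacks makes \<open>v = O(\<mu> + d^2)\<close>; \<open>R\<close>
  collects everything that involves \<open>v\<close>.\<close>

lemma coercivity:
  assumes S: "eventually (\<lambda>k. ls k \<in> S) sequentially"
  obtains c R where "c > 0" "R \<in> O(\<lambda>k. d k * \<mu> k + \<mu> k ^ 2 + d k ^ 3)"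
    "eventually (\<lambda>k. d k ^ 2 \<le> c * ((z k - zs) \<bullet> (lagr_hess \<phi> g zs (ls k) *v (z k - zs))) + R k) sequentially"
proof -
  let ?r = "\<lambda>k. \<mu> k + d k ^ 2"
  let ?H = "\<lambda>v w. lagr_hess \<phi> g zs v *v w"
  define \<Delta> where "\<Delta> k = z k - zs" for k
  \<comment> \<open>A vector orthogonal to all active gradients meets both the equality and the
    inequality constraints of the critical cone.\<close>
  obtain \<xi> where \<xi>: "\<xi> > 0" and coer: "\<And>v w. v \<in> S \<Longrightarrow> (\<And>i. i \<in> B \<Longrightarrow> w \<bullet> G i zs = 0) \<Longrightarrow> \<xi> * norm w ^ 2 \<le> w \<bullet> ?H v w"
    using second_order unfolding second_order_def strongly_active_def
    by (auto simp: inner_commute)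
  obtain M where M: "M > 0" "\<And>v w. v \<in> S \<Longrightarrow> norm (?H v w) \<le> M * norm w"
    using lagr_hess_bounded by metis
  define A :: "real ^ 'n \<Rightarrow> real ^ 'm" where "A w = (\<chi> i. if i \<in> B then w \<bullet> G i zs else 0)" for w
  have linA: "linear A"
    by (rule linearI) (auto simp: A_def vec_eq_iff inner_add_left)
  \<comment> \<open>\<open>P\<close> inverts \<open>A\<close> on its range, so subtracting
    \<open>P (A w)\<close> from \<open>w\<close> moves it into the null space of \<open>A\<close> at
    a cost proportional to \<open>norm (A w)\<close>.\<close>
  obtain P where P: "linear P" "\<And>w. A (P (A w)) = A w"
    using linear_exists_right_inverse_on[OF linA subspace_UNIV] by auto
  obtain K where K: "K > 0" "\<And>x. norm (P x) \<le> norm x * K"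
    using bounded_linear.pos_bounded[OF linear_conv_bounded_linear[THEN iffD1, OF P(1)]] by blast
  define v where "v k = P (A (\<Delta> k))" for k
  \<comment> \<open>The factor \<open>2 / \<xi>\<close> combines the second-order constant with
    \<open>d^2 \<le> 2 |u|^2 + 2 |v|^2\<close>; the terms with \<open>M\<close> bound the form on
    pairs involving \<open>v\<close>.\<close>
  define R where "R k = (2 * M / \<xi>) * (2 * (d k * norm (v k)) + norm (v k) * norm (v k)) + 2 * (norm (v k) * norm (v k))" for k
  have A: "(\<lambda>k. norm (A (\<Delta> k))) \<in> O(?r)"
  proof -
    have 1: "(\<lambda>k. \<Delta> k \<bullet> G i zs) \<in> O(?r)" if i: "i \<in> B" for i
    proof -
      \<comment> \<open>For active \<open>i\<close> this expression collapses to
        \<open>\<Delta> \<bullet> G i zs\<close>: primal residual minus slack minus Taylor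
        remainder.\<close>
      have "(\<lambda>k. (g (z k) $ i + s k $ i) - s k $ i - (g (z k) $ i - g zs $ i - (z k - zs) \<bullet> G i zs)) \<in> O(?r)"
        by (rule sum_in_bigo(2)[OF sum_in_bigo(2)[OF landau_o.big_trans[OF g_s_bigo bigo_plus(3)] s_active_bigo[OF i]]
            landau_o.big_trans[OF g_taylor bigo_plus(4)]])
      then show ?thesis using i by (simp add: active_def \<Delta>_def)
    qed
    have 2: "(\<lambda>k. A (\<Delta> k) $ i) \<in> O(?r)" for i
      using 1[of i] by (cases "i \<in> B") (simp_all add: A_def)
    have "(\<lambda>k. norm (A (\<Delta> k))) \<in> O(\<lambda>k. \<Sum>i\<in>UNIV. \<bar>A (\<Delta> k) $ i\<bar>)"
      by (rule bigoI[of _ 1]) (simp add: norm_le_l1_cart)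
    also have "(\<lambda>k. \<Sum>i\<in>UNIV. \<bar>A (\<Delta> k) $ i\<bar>) \<in> O(?r)"
      using 2 by (intro big_sum_in_bigo) simp
    finally show ?thesis .
  qed
  have v: "(\<lambda>k. norm (v k)) \<in> O(?r)"
    by (rule landau_o.big_trans[OF _ A], rule bigoI[of _ K]) (use K(2) in \<open>simp add: v_def mult.commute\<close>)
  have "R \<in> O(\<lambda>k. d k * ?r k + ?r k * ?r k)"
  proof -
    have 1: "(\<lambda>k. d k * norm (v k)) \<in> O(\<lambda>k. d k * ?r k + ?r k * ?r k)"
      by (rule landau_o.big_trans[OF landau_o.big.mult[OF landau_o.big_refl v]], rule bigoI[of _ 1])
        (use mu_pos in \<open>simp add: add_nonneg_nonneg less_imp_le\<close>)
    have 2: "(\<lambda>k. norm (v k) * norm (v k)) \<in> O(\<lambda>k. d k * ?r k + ?r k * ?r k)"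
      by (rule landau_o.big_trans[OF landau_o.big.mult[OF v v]], rule bigoI[of _ 1])
        (use mu_pos in \<open>simp add: add_nonneg_nonneg less_imp_le\<close>)
    have cmult: "(\<lambda>k. a * f k) \<in> O(h)" if "f \<in> O(h)" for a and f h :: "nat \<Rightarrow> real"
      using that by (cases "a = 0") auto
    show ?thesis unfolding R_def[abs_def]
      by (intro sum_in_bigo(1) cmult 1 2)
  qed
  also have "(\<lambda>k. d k * ?r k + ?r k * ?r k) \<in> O(\<lambda>k. d k * \<mu> k + \<mu> k ^ 2 + d k ^ 3)"
  proof (rule bigoI[of _ 3])
    show "eventually (\<lambda>k. norm (d k * ?r k + ?r k * ?r k) \<le> 3 * norm (d k * \<mu> k + \<mu> k ^ 2 + d k ^ 3)) sequentially"
      using eventually_d_le[OF zero_less_one]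
    proof eventually_elim
      case (elim k)
      have mu: "0 < \<mu> k" and d: "0 \<le> d k" using mu_pos by auto
      have a: "d k * (d k * \<mu> k) \<le> 1 * (d k * \<mu> k)" using elim mu by (intro mult_right_mono) auto
      have b: "d k * d k ^ 3 \<le> 1 * d k ^ 3" using elim by (intro mult_right_mono) auto
      have "d k * ?r k + ?r k * ?r k = d k * \<mu> k + d k ^ 3 + \<mu> k ^ 2 + 2 * (d k * (d k * \<mu> k)) + d k * d k ^ 3"
        by (simp add: algebra_simps power2_eq_square power3_eq_cube)
      also have "\<dots> \<le> 3 * (d k * \<mu> k + \<mu> k ^ 2 + d k ^ 3)"
      proof -
        have "y + q + r + 2 * x + p \<le> 3 * (y + r + q)"
          if "x \<le> y" "p \<le> q" "0 \<le> y" "0 \<le> q" "0 \<le> r" for x y p q r :: real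
          using that by simp
        from this[OF a[unfolded mult_1] b[unfolded mult_1]] show ?thesis using mu d by simp
      qed
      finally show ?case using mu d by (simp add: abs_of_nonneg)
    qed
  qed
  finally have "R \<in> O(\<lambda>k. d k * \<mu> k + \<mu> k ^ 2 + d k ^ 3)" .
  moreover have "eventually (\<lambda>k. d k ^ 2 \<le> (2 / \<xi>) * (\<Delta> k \<bullet> ?H (ls k) (\<Delta> k)) + R k) sequentially"
    using S
  proof eventually_elim
    case (elim k)
    define u where "u = \<Delta> k - v k"
    have \<Delta>: "\<Delta> k = u + v k" by (simp add: u_def)
    have "A u = 0" unfolding u_def v_def linear_diff[OF linA] P(2) by simp
    then have "u \<bullet> G i zs = 0" if "i \<in> B" for i
      using that by (auto simp: A_def vec_eq_iff split: if_splits)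
    then have "\<xi> * norm u ^ 2 \<le> u \<bullet> ?H (ls k) u" by (intro coer elim)
    also have "\<dots> = \<Delta> k \<bullet> ?H (ls k) (\<Delta> k) - \<Delta> k \<bullet> ?H (ls k) (v k) - v k \<bullet> ?H (ls k) (\<Delta> k) + v k \<bullet> ?H (ls k) (v k)"
      by (simp add: u_def matrix_vector_mult_diff_distrib inner_diff_left inner_diff_right)
    also have "\<dots> \<le> \<Delta> k \<bullet> ?H (ls k) (\<Delta> k) + M * (2 * (d k * norm (v k)) + norm (v k) * norm (v k))"
    proof -
      have b: "\<bar>x \<bullet> ?H (ls k) y\<bar> \<le> M * (norm x * norm y)" for x y
      proof -
        have "\<bar>x \<bullet> ?H (ls k) y\<bar> \<le> norm x * norm (?H (ls k) y)" by (rule Cauchy_Schwarz_ineq2)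
        also have "\<dots> \<le> norm x * (M * norm y)" using M(2)[OF elim] by (intro mult_left_mono) auto
        finally show ?thesis by (simp add: mult_ac)
      qed
      show ?thesis
        using b[of "\<Delta> k" "v k"] b[of "v k" "\<Delta> k"] b[of "v k" "v k"]
        by (simp add: \<Delta>_def algebra_simps abs_le_iff)
    qed
    finally have "norm u ^ 2 \<le> (1 / \<xi>) * (\<Delta> k \<bullet> ?H (ls k) (\<Delta> k) + M * (2 * (d k * norm (v k)) + norm (v k) * norm (v k)))"
      using \<xi> by (simp add: field_simps)
    moreover have "d k ^ 2 \<le> 2 * norm u ^ 2 + 2 * norm (v k) ^ 2"
    proof -
      have "d k \<le> norm u + norm (v k)" using norm_triangle_ineq[of u "v k"] \<Delta> by (simp add: \<Delta>_def)
      then have "d k ^ 2 \<le> (norm u + norm (v k)) ^ 2" by (intro power_mono) auto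
      then show ?thesis using sum_squares_bound[of "norm u" "norm (v k)"]
        by (simp add: power2_sum)
    qed
    moreover have "x \<le> (2 / \<xi>) * a + ((2 * M / \<xi>) * b + 2 * n)"
      if "y \<le> (1 / \<xi>) * (a + M * b)" "x \<le> 2 * y + 2 * n" for a b n x y
    proof -
      have "(2 / \<xi>) * a + (2 * M / \<xi>) * b = 2 * ((1 / \<xi>) * (a + M * b))"
        by (simp add: algebra_simps add_divide_distrib)
      with that show ?thesis by linarith
    qed
    ultimately show ?case
      unfolding R_def power2_eq_square by blast
  qed
  ultimately show ?thesis using \<xi> by (intro that[of "2 / \<xi>" R]) (auto simp: \<Delta>_def)
qed

lemma quadratic_growth:
  assumes S: "eventually (\<lambda>k. ls k \<in> S) sequentially" and lim: "(\<lambda>k. l k - ls k) \<longlonglongrightarrow> 0"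
  obtains c K where "c > 0" "K > 0"
    "eventually (\<lambda>k. d k ^ 2 \<le> c * - (\<Sum>i\<in>UNIV. (l k - ls k) $ i * (g (z k) $ i - g zs $ i))
       + K * (d k * \<mu> k + \<mu> k ^ 2)) sequentially"
proof -
  obtain R1 R2 where R1: "R1 \<in> O(\<lambda>k. d k * \<mu> k)" and R2: "R2 \<in> o(\<lambda>k. d k ^ 2)"
    and id: "eventually (\<lambda>k. (z k - zs) \<bullet> (lagr_hess \<phi> g zs (ls k) *v (z k - zs)) =
       - (\<Sum>i\<in>UNIV. (l k - ls k) $ i * (g (z k) $ i - g zs $ i)) + R1 k + R2 k) sequentially"
    using quadratic_form_identity[OF S lim] by blast
  obtain c R where c: "c > 0" and R: "R \<in> O(\<lambda>k. d k * \<mu> k + \<mu> k ^ 2 + d k ^ 3)"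
    and coer: "eventually (\<lambda>k. d k ^ 2 \<le> c * ((z k - zs) \<bullet> (lagr_hess \<phi> g zs (ls k) *v (z k - zs))) + R k) sequentially"
    using coercivity[OF S] by blast
  obtain K1 where K1: "K1 > 0" "eventually (\<lambda>k. norm (R1 k) \<le> K1 * norm (d k * \<mu> k)) sequentially"
    using R1 by (elim landau_o.bigE)
  obtain K2 where K2: "K2 > 0" "eventually (\<lambda>k. norm (R k) \<le> K2 * norm (d k * \<mu> k + \<mu> k ^ 2 + d k ^ 3)) sequentially"
    using R by (elim landau_o.bigE)
  \<comment> \<open>The constants \<open>1 / (4 * c)\<close> here and \<open>1 / (4 * K2)\<close>
    below make the \<open>o(d^2)\<close> and \<open>d^3\<close> errors at most
    \<open>d^2 / 4\<close> each. Half of \<open>d^2\<close> survives on the left, hence the doubled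
    constants.\<close>
  have small: "eventually (\<lambda>k. norm (R2 k) \<le> 1 / (4 * c) * norm (d k ^ 2)) sequentially"
    using R2 c by (intro landau_o.smallD) auto
  have "1 / (4 * K2) > 0" using K2(1) by simp
  from eventually_d_le[OF this] have "eventually (\<lambda>k. d k ^ 2 \<le>
      (2 * c) * - (\<Sum>i\<in>UNIV. (l k - ls k) $ i * (g (z k) $ i - g zs $ i))
       + 2 * (c * K1 + K2) * (d k * \<mu> k + \<mu> k ^ 2)) sequentially"
    using id coer K1(2) K2(2) small
  proof eventually_elim
    case (elim k)
    have mu: "0 < \<mu> k" and d: "0 \<le> d k" using mu_pos by auto
    let ?s = "- (\<Sum>i\<in>UNIV. (l k - ls k) $ i * (g (z k) $ i - g zs $ i))"
    have 1: "d k ^ 2 \<le> c * ?s + c * R1 k + c * R2 k + R k"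
      using elim(3) unfolding elim(2) by (simp add: algebra_simps)
    have 2: "c * R1 k \<le> c * K1 * (d k * \<mu> k)"
      using elim(4) c mu d by (simp add: mult.assoc mult_left_mono abs_le_iff)
    have 3: "c * R2 k \<le> d k ^ 2 / 4"
    proof -
      have "c * R2 k \<le> c * (1 / (4 * c) * d k ^ 2)" using elim(6) c by (intro mult_left_mono) auto
      then show ?thesis using c by simp
    qed
    have "K2 * d k ^ 3 = K2 * d k * d k ^ 2" by (simp add: power2_eq_square power3_eq_cube)
    also have "\<dots> \<le> 1 / 4 * d k ^ 2"
      using elim(1) K2(1) by (intro mult_right_mono) (auto simp: field_simps)
    finally have 4: "R k \<le> K2 * (d k * \<mu> k + \<mu> k ^ 2) + d k ^ 2 / 4"
      using elim(5) mu d by (simp add: algebra_simps abs_le_iff)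
    have 5: "0 \<le> c * K1 * \<mu> k ^ 2" using c K1(1) by simp
    show ?case using 1 2 3 4 5 by (simp add: algebra_simps)
  qed
  then show ?thesis using c K1(1) K2(1) by (intro that[of "2 * c" "2 * (c * K1 + K2)"]) (auto intro: add_pos_pos)
qed

section \<open>The preliminary rate \<open>d^2 = O(\<mu>)\<close>\<close>

lemma g_diff_bigo: "(\<lambda>k. g (z k) $ i - g zs $ i) \<in> O(d)"
  using has_derivative_bigo[OF has_derivative_grad[OF g_diff] z_tendsto, of i] by simp

lemma d_bigo_1: "d \<in> O(\<lambda>_. 1)"
  using eventually_d_le[OF zero_less_one] by (intro bigoI[of _ 1]) simp

text \<open>On \<open>B\<close> the increment of \<open>g_i\<close> is
  \<open>(g_i + s_i) - s_i\<close>, so the growth bound contains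
  \<open>(l_i - ls_i) s_i \<le> l_i s_i\<close>. The sign of \<open>ls_i s_i\<close> thus replaces
  any rate for \<open>l - ls\<close>, and what remains is \<open>O(\<mu>)\<close>.\<close>

lemma d_sq_bigo: "(\<lambda>k. d k ^ 2) \<in> O(\<mu>)"
proof -
  obtain ls where ls: "\<And>k. ls k \<in> S" and lim: "(\<lambda>k. l k - ls k) \<longlonglongrightarrow> 0"
    using ex_near_multipliers by blast
  obtain c K where c: "c > 0" and K: "K > 0" and growth: "eventually (\<lambda>k. d k ^ 2 \<le>
      c * - (\<Sum>i\<in>UNIV. (l k - ls k) $ i * (g (z k) $ i - g zs $ i)) + K * (d k * \<mu> k + \<mu> k ^ 2)) sequentially"
    by (rule quadratic_growth[OF always_eventually lim]) (use ls in auto)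
  define P where "P i k = (if i \<in> B then (l k - ls k) $ i * (g (z k) $ i + s k $ i)
    else l k $ i * (g (z k) $ i - g zs $ i))" for i k
  have P: "P i \<in> O(\<mu>)" for i
  proof (cases "i \<in> B")
    case True
    have "(\<lambda>k. (l k - ls k) $ i * (g (z k) $ i + s k $ i)) \<in> O(\<lambda>k. 1 * \<mu> k)"
      by (intro landau_o.big.mult g_s_bigo landau_o.small_imp_big component_smallo_1 lim)
    then show ?thesis using True by (simp add: P_def[abs_def])
  next
    case False
    have "(\<lambda>k. l k $ i * (g (z k) $ i - g zs $ i)) \<in> O(\<lambda>k. \<mu> k * 1)"
      by (intro landau_o.big.mult l_inactive_bigo False landau_o.big_trans[OF g_diff_bigo d_bigo_1])
    then show ?thesis using False by (simp add: P_def[abs_def])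
  qed
  have le: "- (\<Sum>i\<in>UNIV. (l k - ls k) $ i * (g (z k) $ i - g zs $ i)) \<le>
      real CARD('m) * \<mu> k - (\<Sum>i\<in>UNIV. P i k)" for k
  proof -
    \<comment> \<open>On \<open>B\<close> the discarded term is \<open>- ls_i s_i \<le> 0\<close>.
      Off \<open>B\<close>, \<open>ls_i\<close> is zero and the nonnegative \<open>l_i s_i\<close>
      is added to give a common form.\<close>
    have "- ((l k - ls k) $ i * (g (z k) $ i - g zs $ i)) \<le> l k $ i * s k $ i - P i k" for i
    proof (cases "i \<in> B")
      case True
      have "0 \<le> ls k $ i * s k $ i" using ls[of k] s_pos[of k i] by (simp add: mem_S_iff)
      then show ?thesis using True by (simp add: P_def active_def algebra_simps)
    next
      case False
      have "0 \<le> l k $ i * s k $ i" using l_pos[of k i] s_pos[of k i] by simp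
      moreover have "ls k $ i = 0" using ls[of k] False by (simp add: mem_S_iff)
      ultimately show ?thesis using False by (simp add: P_def algebra_simps)
    qed
    then have "(\<Sum>i\<in>UNIV. - ((l k - ls k) $ i * (g (z k) $ i - g zs $ i))) \<le> (\<Sum>i\<in>UNIV. l k $ i * s k $ i - P i k)"
      by (intro sum_mono)
    then show ?thesis using sum_l_s_le[of k UNIV] by (simp add: sum_negf sum_subtractf)
  qed
  have "(\<lambda>k. \<Sum>i\<in>UNIV. P i k) \<in> O(\<mu>)" by (intro big_sum_in_bigo P)
  then obtain L where L: "L > 0" "eventually (\<lambda>k. norm (\<Sum>i\<in>UNIV. P i k) \<le> L * norm (\<mu> k)) sequentially"
    by (elim landau_o.bigE)
  have "eventually (\<lambda>k. norm (d k ^ 2) \<le> (c * (real CARD('m) + L) + 2 * K) * norm (\<mu> k)) sequentially"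
    using growth L(2) eventually_d_le[OF zero_less_one] eventually_mu_le[OF zero_less_one]
  proof eventually_elim
    case (elim k)
    have mu: "0 < \<mu> k" using mu_pos .
    have "- (\<Sum>i\<in>UNIV. (l k - ls k) $ i * (g (z k) $ i - g zs $ i)) \<le> (real CARD('m) + L) * \<mu> k"
      using le[of k] elim(2) mu by (simp add: algebra_simps abs_le_iff)
    then have "c * - (\<Sum>i\<in>UNIV. (l k - ls k) $ i * (g (z k) $ i - g zs $ i)) \<le> c * ((real CARD('m) + L) * \<mu> k)"
      using c by (intro mult_left_mono) auto
    moreover have "d k * \<mu> k + \<mu> k ^ 2 \<le> 2 * \<mu> k"
      using mult_right_mono[OF elim(3) less_imp_le[OF mu]] mult_right_mono[OF elim(4) less_imp_le[OF mu]]
      by (simp add: power2_eq_square)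
    then have "K * (d k * \<mu> k + \<mu> k ^ 2) \<le> K * (2 * \<mu> k)" using K by (intro mult_left_mono) auto
    ultimately show ?case using elim(1) mu by (simp add: algebra_simps)
  qed
  then show ?thesis by (rule bigoI)
qed

section \<open>Projection onto the multiplier set\<close>

lemma s_active_bigo_mu:
  assumes "i \<in> B" shows "(\<lambda>k. s k $ i) \<in> O(\<mu>)"
proof -
  have "(\<lambda>k. \<mu> k + d k ^ 2) \<in> O(\<mu>)" by (intro sum_in_bigo d_sq_bigo) simp
  with s_active_bigo[OF assms] show ?thesis by (rule landau_o.big_trans)
qed

text \<open>With \<open>s_i \<le> K \<mu>\<close> on \<open>B\<close>, the centrality bound
  \<open>\<gamma> \<mu> \<le> l_i s_i\<close> leaves \<open>l_i \<ge> \<gamma> / K\<close>.\<close>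

lemma l_active_lower_bound:
  assumes "i \<in> B" obtains c where "c > 0" "eventually (\<lambda>k. c \<le> l k $ i) sequentially"
proof -
  obtain K where K: "K > 0" "eventually (\<lambda>k. norm (s k $ i) \<le> K * norm (\<mu> k)) sequentially"
    using s_active_bigo_mu[OF assms] by (elim landau_o.bigE)
  from K(2) have "eventually (\<lambda>k. \<gamma> / K \<le> l k $ i) sequentially"
  proof eventually_elim
    case (elim k)
    have "\<gamma> * \<mu> k \<le> l k $ i * s k $ i" by (rule l_s_ge)
    also have "\<dots> \<le> l k $ i * (K * \<mu> k)"
      using elim l_pos[of k i] mu_pos[of k] by (intro mult_left_mono) auto
    finally have "\<gamma> * \<mu> k \<le> (l k $ i * K) * \<mu> k" by (simp add: mult_ac)
    then have "\<gamma> \<le> l k $ i * K" using mu_pos[of k] by (rule mult_right_le_imp_le)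
    then show ?case using K(1) by (simp add: field_simps)
  qed
  then show ?thesis using \<gamma> K(1) by (intro that[of "\<gamma> / K"]) auto
qed

lemma mu_plus_d_tendsto:
  assumes "f \<in> O(\<lambda>k. \<mu> k + d k)" shows "f \<longlonglongrightarrow> (0 :: real)"
proof -
  have "(\<lambda>k. \<mu> k + d k) \<longlonglongrightarrow> 0" using tendsto_add[OF gap_tendsto d_tendsto] by simp
  then have "(\<lambda>k. \<mu> k + d k) \<in> o(\<lambda>_. 1)" by (intro smalloI_tendsto) auto
  with assms have "f \<in> o(\<lambda>_. 1)" by (rule landau_o.big_small_trans)
  from smalloD_tendsto[OF this] show ?thesis by simp
qed

text \<open>Zero the inactive components, then correct the active ones linearly until stationarity
  is exact. Both changes are \<open>O(\<mu> + d)\<close>; the active components stay positive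
  because they are bounded away from zero while the correction vanishes.\<close>

lemma ex_projected_multipliers:
  obtains ls where "eventually (\<lambda>k. ls k \<in> S) sequentially"
    "(\<lambda>k. norm (l k - ls k)) \<in> O(\<lambda>k. \<mu> k + d k)"
proof -
  define V where "V = {x :: real ^ 'm. \<forall>i. i \<notin> B \<longrightarrow> x $ i = 0}"
  define T where "T x = (\<Sum>i\<in>UNIV. x $ i *\<^sub>R G i zs)" for x :: "real ^ 'm"
  have linT: "linear T"
    by (rule linearI) (simp_all add: T_def scaleR_left_distrib sum.distrib scaleR_sum_right)
  have "subspace V" by (auto simp: V_def subspace_def)
  \<comment> \<open>The right inverse takes values in \<open>V\<close>, so corrections by
    \<open>P\<close> never disturb inactive components.\<close>
  from linear_exists_right_inverse_on[OF linT this]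
  obtain P where P: "\<And>y. P y \<in> V" "linear P" "\<And>x. x \<in> V \<Longrightarrow> T (P (T x)) = T x" by blast
  obtain K where K: "K > 0" "\<And>x. norm (P x) \<le> norm x * K"
    using bounded_linear.pos_bounded[OF linear_conv_bounded_linear[THEN iffD1, OF P(2)]] by blast
  define lN where "lN k = (\<chi> i. if i \<in> B then 0 else l k $ i)" for k
  define y where "y k = F zs + T (l k - lN k)" for k
  define ls where "ls k = l k - lN k - P (y k)" for k
  have lN: "(\<lambda>k. norm (lN k)) \<in> O(\<lambda>k. \<mu> k + d k)"
  proof -
    have "(\<lambda>k. norm (lN k)) \<in> O(\<lambda>k. \<Sum>i\<in>UNIV. \<bar>lN k $ i\<bar>)"
      by (rule bigoI[of _ 1]) (simp add: norm_le_l1_cart)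
    also have "(\<lambda>k. \<Sum>i\<in>UNIV. \<bar>lN k $ i\<bar>) \<in> O(\<mu>)"
    proof (intro big_sum_in_bigo)
      show "(\<lambda>k. \<bar>lN k $ i\<bar>) \<in> O(\<mu>)" for i
        using l_inactive_bigo[of i] by (cases "i \<in> B") (simp_all add: lN_def)
    qed
    also note bigo_plus(1)
    finally show ?thesis .
  qed
  have y: "(\<lambda>k. norm (y k)) \<in> O(\<lambda>k. \<mu> k + d k)"
  proof -
    have "y k = (F zs + (\<Sum>i\<in>UNIV. l k $ i *\<^sub>R G i zs)) + T (- lN k)" for k
      unfolding y_def by (simp add: linear_diff[OF linT] linear_neg[OF linT]) (simp add: T_def)
    moreover have "(\<lambda>k. norm (T (- lN k))) \<in> O(\<lambda>k. \<mu> k + d k)"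
    proof -
      obtain K' where "\<And>x. norm (T x) \<le> norm x * K'"
        using bounded_linear.pos_bounded[OF linear_conv_bounded_linear[THEN iffD1, OF linT]] by blast
      from this[of "- lN _"] have "(\<lambda>k. norm (T (- lN k))) \<in> O(\<lambda>k. norm (lN k))"
        by (intro bigoI[of _ K']) (simp add: mult.commute)
      then show ?thesis using lN by (rule landau_o.big_trans)
    qed
    ultimately show ?thesis using residual_bigo by (simp only: norm_add_bigo)
  qed
  have Py: "(\<lambda>k. norm (P (y k))) \<in> O(\<lambda>k. \<mu> k + d k)"
    by (rule landau_o.big_trans[OF _ y], rule bigoI[of _ K]) (use K(2) in \<open>simp add: mult.commute\<close>)
  have "(\<lambda>k. norm (l k - ls k)) \<in> O(\<lambda>k. \<mu> k + d k)"
    using norm_add_bigo[OF lN Py] by (simp add: ls_def)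
  moreover have "eventually (\<lambda>k. \<forall>i. 0 \<le> ls k $ i) sequentially"
  proof (rule eventually_all_finite)
    fix i
    show "eventually (\<lambda>k. 0 \<le> ls k $ i) sequentially"
    proof (cases "i \<in> B")
      case True
      obtain c where c: "c > 0" "eventually (\<lambda>k. c \<le> l k $ i) sequentially"
        using l_active_lower_bound[OF True] .
      have "eventually (\<lambda>k. norm (P (y k)) < c) sequentially"
        using order_tendstoD(2)[OF mu_plus_d_tendsto[OF Py] c(1)] .
      with c(2) show ?thesis
      proof eventually_elim
        case (elim k)
        then show ?case using True component_le_norm_cart[of "P (y k)" i] by (simp add: ls_def lN_def)
      qed
    next
      case False
      then show ?thesis using P(1) by (simp add: ls_def lN_def V_def)
    qed
  qed
  then have "eventually (\<lambda>k. ls k \<in> S) sequentially"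
  proof eventually_elim
    case (elim k)
    have V: "l k - lN k - lh \<in> V" "\<And>i. i \<notin> B \<Longrightarrow> ls k $ i = 0"
      using lh P(1)[of "y k"] by (auto simp: V_def lN_def ls_def mem_S_iff)
    have Tlh: "F zs + T lh = 0" using lh by (simp add: T_def mem_S_iff)
    \<comment> \<open>Stationarity of \<open>lh\<close> places the residual \<open>y k\<close> in
      the image of \<open>V\<close> under \<open>T\<close>, where \<open>P\<close> inverts
      \<open>T\<close>; subtracting \<open>P (y k)\<close> therefore cancels it exactly.\<close>
    then have y: "y k = T (l k - lN k - lh)" unfolding y_def linear_diff[OF linT, of _ lh]
      by (simp add: eq_neg_iff_add_eq_0[symmetric])
    have "F zs + T (ls k) = F zs + T (l k - lN k) - T (P (y k))"
      unfolding ls_def linear_diff[OF linT, of _ "P _"] by simp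
    also have "\<dots> = 0" unfolding y P(3)[OF V(1)] unfolding y[symmetric] y_def by simp
    finally show ?case using elim V(2) by (simp add: mem_S_iff T_def)
  qed
  ultimately show ?thesis by (intro that)
qed

section \<open>The final rate \<open>O(\<mu>)\<close>\<close>

text \<open>For the projected multipliers, \<open>l - ls = O(\<mu> + d)\<close> meets increments of
  active constraints that are now \<open>O(\<mu>)\<close>. Quadratic growth then gives
  \<open>d^2 = O(\<mu>^2 + d \<mu>)\<close>, hence \<open>d = O(\<mu>)\<close>, and the multiplier
  error follows.\<close>

lemma sol_dist_bigo: "(\<lambda>k. sol_dist \<phi> g zs (z k) (l k)) \<in> O(\<mu>)"
proof -
  obtain ls where ls: "eventually (\<lambda>k. ls k \<in> S) sequentially"
    and near: "(\<lambda>k. norm (l k - ls k)) \<in> O(\<lambda>k. \<mu> k + d k)"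
    using ex_projected_multipliers .
  have lim: "(\<lambda>k. l k - ls k) \<longlonglongrightarrow> 0"
    using mu_plus_d_tendsto[OF near] by (rule tendsto_norm_zero_cancel)
  obtain c K where c: "c > 0" and K: "K > 0" and growth: "eventually (\<lambda>k. d k ^ 2 \<le>
      c * - (\<Sum>i\<in>UNIV. (l k - ls k) $ i * (g (z k) $ i - g zs $ i)) + K * (d k * \<mu> k + \<mu> k ^ 2)) sequentially"
    using quadratic_growth[OF ls lim] .
  have "(\<lambda>k. (l k - ls k) $ i * (g (z k) $ i - g zs $ i)) \<in> O(\<lambda>k. (\<mu> k + d k) * \<mu> k)" for i
  proof (cases "i \<in> B")
    case True
    have e: "(\<lambda>k. (l k - ls k) $ i) \<in> O(\<lambda>k. \<mu> k + d k)"
      by (rule landau_o.big_trans[OF _ near], rule bigoI[of _ 1])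
        (auto intro!: always_eventually component_le_norm_cart simp del: vector_minus_component)
    have "(\<lambda>k. (g (z k) $ i + s k $ i) - s k $ i) \<in> O(\<mu>)"
      by (intro sum_in_bigo g_s_bigo s_active_bigo_mu True)
    then have "(\<lambda>k. g (z k) $ i - g zs $ i) \<in> O(\<mu>)"
      using True by (simp add: active_def)
    with e show ?thesis by (rule landau_o.big.mult)
  next
    case False
    \<comment> \<open>The roles are exchanged off \<open>B\<close>: the multiplier supplies the
      factor \<open>\<mu>\<close> and the constraint increment supplies \<open>d\<close>.\<close>
    have "(\<lambda>k. l k $ i * (g (z k) $ i - g zs $ i)) \<in> O(\<lambda>k. \<mu> k * (\<mu> k + d k))"
      by (intro landau_o.big.mult l_inactive_bigo False landau_o.big_trans[OF g_diff_bigo bigo_plus(2)])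
    moreover have "eventually (\<lambda>k. (l k - ls k) $ i * (g (z k) $ i - g zs $ i) =
        l k $ i * (g (z k) $ i - g zs $ i)) sequentially"
      using ls by eventually_elim (use False in \<open>simp add: mem_S_iff\<close>)
    ultimately show ?thesis by (subst landau_o.big.in_cong) (simp_all add: mult.commute)
  qed
  then have "(\<lambda>k. \<Sum>i\<in>UNIV. (l k - ls k) $ i * (g (z k) $ i - g zs $ i)) \<in> O(\<lambda>k. (\<mu> k + d k) * \<mu> k)"
    by (intro big_sum_in_bigo)
  then obtain L where L: "L > 0" "eventually (\<lambda>k. norm (\<Sum>i\<in>UNIV. (l k - ls k) $ i * (g (z k) $ i - g zs $ i))
      \<le> L * norm ((\<mu> k + d k) * \<mu> k)) sequentially"
    by (elim landau_o.bigE)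
  have "eventually (\<lambda>k. norm (d k) \<le> (2 * (c * L + K) + 1) * norm (\<mu> k)) sequentially"
    using growth L(2)
  proof eventually_elim
    case (elim k)
    have mu: "0 < \<mu> k" and d: "0 \<le> d k" using mu_pos by auto
    have cLK: "0 \<le> c * L + K" using c L(1) K by simp
    have "c * - (\<Sum>i\<in>UNIV. (l k - ls k) $ i * (g (z k) $ i - g zs $ i)) \<le> c * (L * ((\<mu> k + d k) * \<mu> k))"
      using elim(2) c mu d by (intro mult_left_mono) (auto simp: abs_le_iff)
    then have le: "d k ^ 2 \<le> (c * L + K) * (d k * \<mu> k + \<mu> k ^ 2)"
      using elim(1) by (simp add: algebra_simps power2_eq_square)
    \<comment> \<open>If \<open>d\<close> exceeds \<open>\<mu>\<close>, then
      \<open>\<mu>^2 \<le> d \<mu>\<close>, and a factor \<open>d > 0\<close> cancels from the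
      quadratic inequality.\<close>
    show ?case
    proof (cases "d k \<le> \<mu> k")
      case True
      then show ?thesis using mu mult_nonneg_nonneg[OF cLK, of "\<mu> k"] by (simp add: algebra_simps)
    next
      case False
      then have "\<mu> k ^ 2 \<le> d k * \<mu> k" using mu by (simp add: power2_eq_square)
      then have "(c * L + K) * (d k * \<mu> k + \<mu> k ^ 2) \<le> (c * L + K) * (2 * (d k * \<mu> k))"
        using cLK by (intro mult_left_mono) linarith+
      with le have "d k ^ 2 \<le> (c * L + K) * (2 * (d k * \<mu> k))" by (rule order_trans)
      then have "d k * d k \<le> (2 * (c * L + K) * \<mu> k) * d k"
        by (simp add: power2_eq_square algebra_simps)
      then have "d k \<le> 2 * (c * L + K) * \<mu> k"
        using False mu by (intro mult_right_le_imp_le[of "d k" "d k"]) auto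
      then show ?thesis using mu by (simp add: algebra_simps)
    qed
  qed
  then have d: "d \<in> O(\<mu>)" by (rule bigoI)
  have "(\<lambda>k. sol_dist \<phi> g zs (z k) (l k)) \<in> O(\<lambda>k. d k + norm (l k - ls k))"
  proof (rule bigoI[of _ 1])
    show "eventually (\<lambda>k. norm (sol_dist \<phi> g zs (z k) (l k)) \<le> 1 * norm (d k + norm (l k - ls k))) sequentially"
      using ls
    proof eventually_elim
      case (elim k)
      have "sol_dist \<phi> g zs (z k) (l k) \<le> dist (z k, l k) (zs, ls k)"
        unfolding sol_dist_def using elim by (intro infdist_le) auto
      also have "\<dots> = norm (z k - zs, l k - ls k)" by (simp add: dist_norm)
      also have "\<dots> \<le> d k + norm (l k - ls k)" by (rule norm_Pair_le)
      finally show ?case using infdist_nonneg[of "(z k, l k)"] by (simp add: sol_dist_def)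
    qed
  qed
  also have "(\<lambda>k. d k + norm (l k - ls k)) \<in> O(\<mu>)"
    by (intro sum_in_bigo d landau_o.big_trans[OF near]) auto
  finally show ?thesis .
qed

end

section \<open>Contradiction from a sequence of counterexamples\<close>

theorem theorem3p3:
  fixes \<phi> :: "real ^ 'n \<Rightarrow> real" and g :: "real ^ 'n \<Rightarrow> real ^ 'm"
    and zs :: "real ^ 'n" and C \<gamma> :: real
  assumes "twice_Lipschitz_differentiable \<phi>"
    and "\<forall>i. twice_Lipschitz_differentiable (\<lambda>z. g z $ i)"
    and "nlp_solution \<phi> g zs"
    and "mfcq g zs"
    and "second_order \<phi> g zs"
    and "strict_compl \<phi> g zs"
    and "C > 0" and "0 < \<gamma>" and "\<gamma> < 1"
  shows "\<exists>\<epsilon>>0. \<exists>K>0. \<forall>z l s.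
           (\<forall>i. 0 \<le> l $ i) \<and> centrality \<phi> g C \<gamma> z l s \<and>
           sol_dist \<phi> g zs z l \<le> \<epsilon> \<and> compl_gap l s \<le> \<epsilon>
           \<longrightarrow> sol_dist \<phi> g zs z l \<le> K * compl_gap l s"
proof (rule ccontr)
  assume neg: "\<not> ?thesis"
  \<comment> \<open>Negate with \<open>\<epsilon> = 1 / (k + 1)\<close> and
    \<open>K = k + 1\<close>: the radii tend to zero while the violated constants grow without
    bound.\<close>
  have "\<exists>z l s. centrality \<phi> g C \<gamma> z l s \<and> sol_dist \<phi> g zs z l \<le> inverse (real (Suc k)) \<and>
      compl_gap l s \<le> inverse (real (Suc k)) \<and> sol_dist \<phi> g zs z l > real (Suc k) * compl_gap l s" for k
  proof -
    have "inverse (real (Suc k)) > 0" "real (Suc k) > 0" by auto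
    with neg show ?thesis unfolding not_ex not_all not_imp de_Morgan_conj by (meson not_le)
  qed
  then obtain z l s where zls: "\<And>k. centrality \<phi> g C \<gamma> (z k) (l k) (s k)"
      "\<And>k. sol_dist \<phi> g zs (z k) (l k) \<le> inverse (real (Suc k))"
      "\<And>k. compl_gap (l k) (s k) \<le> inverse (real (Suc k))"
      "\<And>k. sol_dist \<phi> g zs (z k) (l k) > real (Suc k) * compl_gap (l k) (s k)"
    by metis
  have pos: "0 < l k $ i" "0 < s k $ i" for k i
    using zls(1)[of k] by (auto simp: centrality_def)
  have gap: "0 \<le> compl_gap (l k) (s k)" for k
    unfolding compl_gap_def inner_vec_def
    by (intro divide_nonneg_nonneg sum_nonneg) (simp_all add: less_imp_le[OF pos(1)] less_imp_le[OF pos(2)])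
  obtain lh where lh: "lh \<in> multipliers \<phi> g zs" "\<And>i. i \<in> active g zs \<Longrightarrow> 0 < lh $ i"
    using assms(6) by (auto simp: strict_compl_def)
  interpret central_sequence \<phi> g zs C \<gamma> lh z l s
  proof
    show "(\<lambda>k. sol_dist \<phi> g zs (z k) (l k)) \<longlonglongrightarrow> 0"
      using zls(2) by (intro Lim_null_comparison[OF always_eventually LIMSEQ_inverse_real_of_nat])
        (auto simp: sol_dist_def infdist_nonneg)
    show "(\<lambda>k. compl_gap (l k) (s k)) \<longlonglongrightarrow> 0"
      using zls(3) gap by (intro Lim_null_comparison[OF always_eventually LIMSEQ_inverse_real_of_nat]) auto
  qed (use assms lh zls(1) in auto)
  obtain K where "eventually (\<lambda>k. norm (sol_dist \<phi> g zs (z k) (l k)) \<le> K * norm (compl_gap (l k) (s k))) sequentially"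
    using sol_dist_bigo by (elim landau_o.bigE)
  moreover have "eventually (\<lambda>k. K \<le> real k) sequentially"
    using filterlim_real_sequentially by (auto simp: filterlim_at_top)
  ultimately have "eventually (\<lambda>k. False) sequentially"
  proof eventually_elim
    case (elim k)
    have "sol_dist \<phi> g zs (z k) (l k) \<le> K * compl_gap (l k) (s k)" using elim(1) gap[of k] by simp
    also have "\<dots> \<le> real (Suc k) * compl_gap (l k) (s k)"
      using elim(2) gap[of k] by (intro mult_right_mono) auto
    finally show ?case using zls(4)[of k] by simp
  qed
  then show False by simp
qed

end
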